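(* Let $\delta, K, C$ be positive integers such that $\delta\geq 2$, $1\leq K\leq \delta$ and $2\delta+K<C\leq 3\delta+1$. Then the class $\overrightarrow{\mathcal A}^\delta_{K,C}$ of all linear orderings of metric spaces in $\mathcal A^\delta_{K,C}$ is a Ramsey class.
   Context: For positive integers $\delta,K,C$, $\mathcal A^\delta_{K,C}$ denotes the class of all finite metric spaces $\mathbf M=(M,d)$ with integer distances such that: (i) $d(x,y)\leq\delta$ for all $x,y\in M$; (ii) the perimeter of every triangle is less than $C$; (iii) if a triangle has odd perimeter, then its perimeter is at least $2K+1$. Here a triangle is any triple of distinct points $u,v,w\in M$, and its perimeter is $d(u,v)+d(v,w)+d(w,u)$. $\overrightarrow{\mathcal A}^\delta_{K,C}$ is the class of all structures $(M,d,\leq)$ where $(M,d)\in\mathcal A^\delta_{K,C}$ and $\leq$ is an arbitrary linear order on $M$. Substructures are subsets with the induced distance and induced order; isomorphisms are order-preserving isometric bijections. For structures $\mathbf A,\mathbf B$, $\binom{\mathbf B}{\mathbf A}$ denotes the set of all substructures of $\mathbf B$ isomorphic to $\mathbf A$. A class $\mathcal C$ of structures is a Ramsey class if for every $\mathbf A,\mathbf B\in\mathcal C$ and every positive integer $k$ there exists $\mathbf C\in\mathcal C$ such that for every partition of $\binom{\mathbf C}{\mathbf A}$ into $k$ classes there exists $\widetilde{\mathbf B}\in\binom{\mathbf C}{\mathbf B}$ such that $\binom{\widetilde{\mathbf B}}{\mathbf A}$ is contained in a single class of the partition. *)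

theory Defs
  imports "HOL-Analysis.Abstract_Metric_Spaces" "HOL-Library.Infinite_Typeclass"
begin

record 'a int_space =
  points :: "'a set"
  distance :: "'a \<Rightarrow> 'a \<Rightarrow> nat"

record 'a ordered_space = "'a int_space" +
  order_rel :: "'a rel"

text \<open>Distances are integral and nonnegative, hence of type \<^typ>\<open>nat\<close>. The values of
  \<^const>\<open>distance\<close> outside the set of points carry no information; \<^locale>\<open>Metric_space\<close>
  only asks that they be symmetric there.\<close>

definition perimeter :: "('a \<Rightarrow> 'a \<Rightarrow> nat) \<Rightarrow> 'a \<Rightarrow> 'a \<Rightarrow> 'a \<Rightarrow> nat" where
  "perimeter d u v w = d u v + d v w + d w u"

definition is_triangle :: "'a set \<Rightarrow> 'a \<Rightarrow> 'a \<Rightarrow> 'a \<Rightarrow> bool" where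
  "is_triangle M u v w \<longleftrightarrow>
     u \<in> M \<and> v \<in> M \<and> w \<in> M \<and> u \<noteq> v \<and> v \<noteq> w \<and> w \<noteq> u"

definition metric_class :: "nat \<Rightarrow> nat \<Rightarrow> nat \<Rightarrow> 'a int_space set" where
  "metric_class \<delta> K C = {X.
     finite (points X) \<and>
     Metric_space (points X) (\<lambda>x y. real (distance X x y)) \<and>
     (\<forall>x\<in>points X. \<forall>y\<in>points X. distance X x y \<le> \<delta>) \<and>
     (\<forall>u v w. is_triangle (points X) u v w \<longrightarrow> perimeter (distance X) u v w < C) \<and>
     (\<forall>u v w. is_triangle (points X) u v w \<longrightarrow> odd (perimeter (distance X) u v w) \<longrightarrow>
        2 * K + 1 \<le> perimeter (distance X) u v w)}"

definition ordered_metric_class :: "nat \<Rightarrow> nat \<Rightarrow> nat \<Rightarrow> 'a ordered_space set" where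
  "ordered_metric_class \<delta> K C = {X.
     int_space.truncate X \<in> metric_class \<delta> K C \<and> linear_order_on (points X) (order_rel X)}"

definition induced :: "'a ordered_space \<Rightarrow> 'a set \<Rightarrow> 'a ordered_space" where
  "induced X S = X\<lparr>points := S, order_rel := order_rel X \<inter> S \<times> S\<rparr>"

definition isomorphic :: "'a ordered_space \<Rightarrow> 'b ordered_space \<Rightarrow> bool" where
  "isomorphic X Y \<longleftrightarrow> (\<exists>f. bij_betw f (points X) (points Y) \<and>
     (\<forall>x\<in>points X. \<forall>y\<in>points X.
        distance Y (f x) (f y) = distance X x y \<and>
        ((f x, f y) \<in> order_rel Y \<longleftrightarrow> (x, y) \<in> order_rel X)))"

definition copies :: "'a ordered_space \<Rightarrow> 'a ordered_space \<Rightarrow> 'a ordered_space set" where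
  "copies B A = {induced B S | S. S \<subseteq> points B \<and> isomorphic (induced B S) A}"

text \<open>As usual in Ramsey theory, the classes of a partition may be empty.\<close>

definition partition_into :: "nat \<Rightarrow> 'b set \<Rightarrow> (nat \<Rightarrow> 'b set) \<Rightarrow> bool" where
  "partition_into k X P \<longleftrightarrow> disjoint_family_on P {..<k} \<and> (\<Union>i<k. P i) = X"

text \<open>All structures live on subsets of the type \<^typ>\<open>'a\<close>. When \<^typ>\<open>'a\<close> is infinite it contains
  every finite structure up to isomorphism, so a class of finite structures is fully represented;
  over a finite \<^typ>\<open>'a\<close> the notion would be meaningless.\<close>

definition Ramsey_class :: "('a::infinite) ordered_space set \<Rightarrow> bool" where
  "Ramsey_class \<C> \<longleftrightarrow> (\<forall>A\<in>\<C>. \<forall>B\<in>\<C>. \<forall>k\<ge>1. \<exists>C\<in>\<C>.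
     \<forall>P. partition_into k (copies C A) P \<longrightarrow>
       (\<exists>B'\<in>copies C B. \<exists>i<k. copies B' A \<subseteq> P i))"

end

theory Submission
  imports Defs "HOL-Library.Ramsey" "HOL-Library.Countable"
begin

text \<open>A finite graph with edges labelled by \<open>{1..\<delta>}\<close> extends to a space of the class as soon as all its
  closed walks are good, that is, violate neither the bounds that triangle inequality and perimeter
  bound impose along walks nor the lower bound on odd perimeters: clamp the distance
  \<open>max K \<lceil>\<delta>/2\<rceil>\<close> between the largest lower and the smallest upper bound. Closed walks of length more
  than \<open>2 \<delta>\<close> are automatically good.

  Start from Ramsey's theorem and iterate the partite construction of Nesetril and Rodl, whose
  partite lemma comes from the Hales--Jewett theorem. A closed walk of length at most \<open>n + 1\<close> in the new
  graph either stays in one copy of the old picture, or stays over a copy of \<open>A\<close>, or splits along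
  a distance of \<open>A\<close> into two walks that project to closed walks of length at most \<open>n\<close>. Hence every
  round increases by one the length up to which closed walks are good, and \<open>2 \<delta>\<close> rounds suffice.\<close>

section \<open>The Hales--Jewett theorem\<close>

text \<open>The hypothesis enters as \<open>2 * \<delta> + K \<le> c\<close>, where
  \<open>c = C - 1\<close> is the largest perimeter allowed, and does three jobs. It keeps the upper
  bound that the perimeter condition imposes along a walk at \<open>K\<close> or above, so an upper
  bound below \<open>K\<close> is a plain sum of labels; thus a short odd triangle of the completion
  unfolds into a short odd closed walk of the graph. It leaves room for a clamping value that can
  occur twice next to any third side. And it makes both bounds trivial within about
  \<open>2 * \<delta>\<close> steps, which limits the number of rounds.

  The obstacle in a partite step is that the two ends of an excursion into a copy need not be joined
  by an edge of the new graph. The split along a distance of \<open>A\<close> therefore takes place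
  on words of labels, where a common label \<open>t\<close> is enough (\<open>good_glue\<close>),
  and only the projections of the halves have to be good in the template. Each half needs two steps
  or more, so that replacing it by one label really shortens the walk; this is where a round gains
  its unit of length.\<close>

definition subst :: "'s option list \<Rightarrow> 's \<Rightarrow> 's list" where
  "subst L s = map (\<lambda>z. case z of None \<Rightarrow> s | Some y \<Rightarrow> y) L"

text \<open>Combinatorial lines: \<open>None\<close> marks the moving coordinates, of which there
  must be at least one.\<close>

definition lines :: "nat \<Rightarrow> 's set \<Rightarrow> 's option list set" where
  "lines N S = {L. length L = N \<and> None \<in> set L \<and> set L \<subseteq> insert None (Some ` S)}"

lemma subst_append [simp]: "subst (L @ L') s = subst L s @ subst L' s"
  by (simp add: subst_def)

lemma subst_map_Some [simp]: "subst (map Some w) s = w"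
  by (induction w) (auto simp: subst_def)

lemma finite_lines: "finite S \<Longrightarrow> finite (lines N S)"
  by (rule finite_subset[OF _ finite_lists_length_eq[of "insert None (Some ` S)" N]])
     (auto simp: lines_def)

lemma set_subst: "L \<in> lines N S \<Longrightarrow> s \<in> T \<Longrightarrow> S \<subseteq> T \<Longrightarrow> set (subst L s) \<subseteq> T"
  by (fastforce simp: lines_def subst_def split: option.splits)

lemma length_subst [simp]: "length (subst L s) = length L"
  by (simp add: subst_def)

lemma lines_append1:
  "L \<in> lines N S \<Longrightarrow> length L' = N' \<Longrightarrow> set L' \<subseteq> insert None (Some ` S) \<Longrightarrow> L @ L' \<in> lines (N + N') S"
  by (auto simp: lines_def)

lemma lines_append2:
  "L' \<in> lines N' S \<Longrightarrow> length L = N \<Longrightarrow> set L \<subseteq> insert None (Some ` S) \<Longrightarrow> L @ L' \<in> lines (N + N') S"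
  by (auto simp: lines_def)

definition hj :: "'s set \<Rightarrow> nat set \<Rightarrow> nat \<Rightarrow> bool" where
  "hj S Q N \<longleftrightarrow> (\<forall>\<psi>. (\<forall>w. \<psi> w \<in> Q) \<longrightarrow> (\<exists>L\<in>lines N S. \<exists>i. \<forall>s\<in>S. \<psi> (subst L s) = i))"

text \<open>Colour focusing: \<^term>\<open>J\<close> is a set of colours of lines that are monochromatic on \<^term>\<open>S\<close> and
  share the value \<^term>\<open>f\<close> at the new letter \<^term>\<open>s0\<close>.\<close>

definition focused :: "'s set \<Rightarrow> 's \<Rightarrow> nat set \<Rightarrow> nat \<Rightarrow> nat \<Rightarrow> bool" where
  "focused S s0 Q r N \<longleftrightarrow> (\<forall>\<psi>. (\<forall>w. \<psi> w \<in> Q) \<longrightarrow>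
    (\<exists>L\<in>lines N (insert s0 S). \<exists>i. \<forall>s\<in>insert s0 S. \<psi> (subst L s) = i) \<or>
    (\<exists>J f. card J = r \<and> finite J \<and> length f = N \<and> set f \<subseteq> insert s0 S \<and>
       (\<forall>i\<in>J. \<exists>L\<in>lines N (insert s0 S). subst L s0 = f \<and> (\<forall>s\<in>S. \<psi> (subst L s) = i))))"

text \<open>Each round puts a line over \<open>S\<close> in front of the lines focused so far; it
  comes from the hypothesis for \<open>S\<close> with a far larger set of colours.\<close>

lemma exists_focused:
  assumes S: "finite S" "S \<noteq> {}" and Q: "finite Q" and IH: "\<And>Q. finite Q \<Longrightarrow> \<exists>N. hj S Q N"
  shows "\<exists>N. focused S s0 Q r N"
proof (induction r)
  case 0
  show ?case unfolding focused_def by (intro exI[of _ 0] allI impI disjI2 exI[of _ "{}"] exI[of _ "[]"]) auto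
next
  case (Suc r)
  let ?T = "insert s0 S"
  obtain N where "focused S s0 Q r N"
    using Suc by blast
  note N = mp[OF spec[OF this[unfolded focused_def]]]
  have "finite {w. set w \<subseteq> ?T \<and> length w = N}"
    using S by (intro finite_lists_length_eq) auto
  from finite_list[OF this] obtain ws where ws: "set ws = {w. set w \<subseteq> ?T \<and> length w = N}" ..
  \<comment> \<open>A word of length \<open>M\<close> is coloured by the list of colours of all its
    extensions by \<open>N\<close> letters of \<open>?T\<close>. On a line monochromatic for this
    colouring, no such suffix distinguishes the letters of \<open>S\<close>.\<close>
  define Q' where "Q' = (to_nat :: nat list \<Rightarrow> nat) ` {xs. set xs \<subseteq> Q \<and> length xs = length ws}"
  have "finite Q'"
    unfolding Q'_def using Q by (intro finite_imageI finite_lists_length_eq)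
  then obtain M where M: "hj S Q' M" using IH by blast
  obtain s1 where s1: "s1 \<in> S" using S by blast
  show ?case
    unfolding focused_def
  proof (intro exI[of _ "M + N"] allI impI)
    fix \<psi> :: "'a list \<Rightarrow> nat" assume \<psi>: "\<forall>w. \<psi> w \<in> Q"
    define \<phi> where "\<phi> u = to_nat (map (\<lambda>w. \<psi> (u @ w)) ws)" for u
    have "\<forall>u. \<phi> u \<in> Q'" unfolding \<phi>_def Q'_def
      using \<psi> by (intro allI imageI) auto
    then obtain L i where L: "L \<in> lines M S" and Li: "\<forall>s\<in>S. \<phi> (subst L s) = i"
      using mp[OF spec[OF M[unfolded hj_def]], of \<phi>] by blast
    have LT: "L \<in> lines M ?T" using L by (auto simp: lines_def)
    have eq: "\<psi> (subst L s @ w) = \<psi> (subst L s1 @ w)"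
      if "s \<in> S" "set w \<subseteq> ?T" "length w = N" for s w
    proof -
      have "\<phi> (subst L s) = \<phi> (subst L s1)" using Li that s1 by simp
      then have "map (\<lambda>w. \<psi> (subst L s @ w)) ws = map (\<lambda>w. \<psi> (subst L s1 @ w)) ws"
        unfolding \<phi>_def by simp
      moreover have "w \<in> set ws" using ws that by simp
      ultimately show ?thesis by (simp add: map_eq_conv)
    qed
    have sL1: "set (subst L s1) \<subseteq> ?T" "length (subst L s1) = M"
      using set_subst[OF LT, of s1 ?T] s1 LT by (auto simp: lines_def)
    have sL0: "set (subst L s0) \<subseteq> ?T" using set_subst[OF LT, of s0 ?T] by auto
    have mono: "\<exists>L\<in>lines (M + N) ?T. \<exists>i. \<forall>s\<in>?T. \<psi> (subst L s) = i"
      if L': "L' \<in> lines N ?T" and m: "\<forall>s\<in>?T. \<psi> (subst L s1 @ subst L' s) = i" for L' i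
    proof (intro bexI exI ballI)
      show "map Some (subst L s1) @ L' \<in> lines (M + N) ?T"
        by (rule lines_append2[OF L']) (use sL1 in auto)
      show "\<psi> (subst (map Some (subst L s1) @ L') s) = i" if s: "s \<in> ?T" for s
        using bspec[OF m s] by simp
    qed
    have "\<forall>w. \<psi> (subst L s1 @ w) \<in> Q" using \<psi> by simp
    from N[OF this]
    show "(\<exists>L\<in>lines (M + N) ?T. \<exists>i. \<forall>s\<in>?T. \<psi> (subst L s) = i) \<or>
      (\<exists>J f. card J = Suc r \<and> finite J \<and> length f = M + N \<and> set f \<subseteq> ?T \<and>
       (\<forall>i\<in>J. \<exists>L\<in>lines (M + N) ?T. subst L s0 = f \<and> (\<forall>s\<in>S. \<psi> (subst L s) = i)))"
    proof (elim disjE)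
      assume "\<exists>L'\<in>lines N ?T. \<exists>i. \<forall>s\<in>?T. \<psi> (subst L s1 @ subst L' s) = i"
      then show ?thesis by (elim bexE exE) (rule disjI1, rule mono)
    next
      assume "\<exists>J f. card J = r \<and> finite J \<and> length f = N \<and> set f \<subseteq> ?T \<and>
       (\<forall>i\<in>J. \<exists>L'\<in>lines N ?T. subst L' s0 = f \<and> (\<forall>s\<in>S. \<psi> (subst L s1 @ subst L' s) = i))"
      then obtain J f where J: "card J = r" "finite J" "length f = N" "set f \<subseteq> ?T"
        and foc: "\<forall>i\<in>J. \<exists>L'\<in>lines N ?T. subst L' s0 = f \<and>
            (\<forall>s\<in>S. \<psi> (subst L s1 @ subst L' s) = i)"
        by (elim exE conjE) (rule that)
      define j where "j = \<psi> (subst L s1 @ f)"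
      show ?thesis
      \<comment> \<open>If \<open>j\<close> is in \<open>J\<close>, the line of colour
        \<open>j\<close> keeps its colour at \<open>s0\<close>, where its value is \<open>f\<close>.
        Otherwise \<open>f\<close> held fixed behind \<open>L\<close> gives a line of the new colour
        \<open>j\<close>, with the same focus as the prolonged old lines.\<close>
      proof (cases "j \<in> J")
        case True
        then obtain L' where L': "L' \<in> lines N ?T" "subst L' s0 = f"
            "\<forall>s\<in>S. \<psi> (subst L s1 @ subst L' s) = j" using bspec[OF foc True] by blast
        then have "\<forall>s\<in>?T. \<psi> (subst L s1 @ subst L' s) = j" by (auto simp: j_def)
        then show ?thesis using mono[OF L'(1)] by blast
      next
        case False
        show ?thesis
        proof (intro disjI2 exI[of _ "insert j J"] exI[of _ "subst L s0 @ f"] conjI ballI)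
          show "card (insert j J) = Suc r" using J False by simp
          show "length (subst L s0 @ f) = M + N" using J L by (simp add: lines_def)
          show "set (subst L s0 @ f) \<subseteq> ?T" using J sL0 by simp
          fix i assume i: "i \<in> insert j J"
          show "\<exists>L'\<in>lines (M + N) ?T. subst L' s0 = subst L s0 @ f \<and> (\<forall>s\<in>S. \<psi> (subst L' s) = i)"
          proof (cases "i = j")
            case True
            show ?thesis
            proof (intro bexI[of _ "L @ map Some f"] conjI ballI)
              show "L @ map Some f \<in> lines (M + N) ?T"
                by (rule lines_append1[OF LT]) (use J in auto)
              show "\<psi> (subst (L @ map Some f) s) = i" if "s \<in> S" for s
                using eq[OF that J(4,3)] True j_def by simp
            qed simp
          next
            case False
            then have "i \<in> J" using i by simp
            from bspec[OF foc this] obtain L' where L': "L' \<in> lines N ?T" "subst L' s0 = f"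
              "\<forall>s\<in>S. \<psi> (subst L s1 @ subst L' s) = i" by blast
            show ?thesis
            proof (intro bexI[of _ "L @ L'"] conjI ballI)
              show "L @ L' \<in> lines (M + N) ?T"
                by (rule lines_append1[OF LT]) (use L' in \<open>auto simp: lines_def\<close>)
              show "\<psi> (subst (L @ L') s) = i" if "s \<in> S" for s
              proof -
                have "set (subst L' s) \<subseteq> ?T" using set_subst[OF L'(1), of s ?T] that by auto
                then show ?thesis using eq[of s "subst L' s"] that L' by (auto simp: lines_def)
              qed
            qed (use L' in simp)
          qed
        qed (use J in auto)
      qed
    qed
  qed
qed

text \<open>Induction on the alphabet. More focused colours than there are colours is impossible, so
  a monochromatic line remains. One-letter alphabets are separate because a colour of
  \<open>J\<close> is realised only if \<open>S\<close> has a letter.\<close>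

theorem hales_jewett:
  assumes "finite S" "finite Q"
  shows "\<exists>N. hj S Q N"
  using assms
proof (induction S arbitrary: Q rule: finite_induct)
  case empty
  have "[None] \<in> lines 1 {}" by (simp add: lines_def)
  then show ?case unfolding hj_def by blast
next
  case (insert s0 S)
  show ?case
  proof (cases "S = {}")
    case True
    have "[None] \<in> lines 1 {s0}" by (simp add: lines_def)
    then show ?thesis using True unfolding hj_def by blast
  next
    case False
    let ?T = "insert s0 S"
    have "\<exists>N. focused S s0 Q (Suc (card Q)) N"
    proof (rule exists_focused)
      show "\<exists>N. hj S Q' N" if "finite Q'" for Q' by (rule insert.IH[OF that])
    qed (use insert False in simp_all)
    then obtain N where N: "focused S s0 Q (Suc (card Q)) N" by blast
    have "hj ?T Q N"
      unfolding hj_def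
    proof (intro allI impI, rule ccontr)
      fix \<psi> :: "'a list \<Rightarrow> nat"
      assume \<psi>: "\<forall>w. \<psi> w \<in> Q" and no: "\<not> (\<exists>L\<in>lines N ?T. \<exists>i. \<forall>s\<in>?T. \<psi> (subst L s) = i)"
      have "\<exists>J f. card J = Suc (card Q) \<and> finite J \<and> length f = N \<and> set f \<subseteq> ?T \<and>
         (\<forall>i\<in>J. \<exists>L\<in>lines N ?T. subst L s0 = f \<and> (\<forall>s\<in>S. \<psi> (subst L s) = i))"
        using mp[OF spec[OF N[unfolded focused_def]] \<psi>] no by (elim disjE) (rule notE, assumption+)
      then obtain J f where J: "card J = Suc (card Q)"
        and Ji: "\<forall>i\<in>J. \<exists>L\<in>lines N ?T. subst L s0 = f \<and> (\<forall>s\<in>S. \<psi> (subst L s) = i)"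
        by (elim exE conjE) (rule that)
      obtain s where s: "s \<in> S" using False by blast
      have "J \<subseteq> Q"
      proof
        fix i assume "i \<in> J"
        from bspec[OF Ji this] s obtain L where "\<psi> (subst L s) = i" by blast
        then show "i \<in> Q" using \<psi> by blast
      qed
      then show False using J card_mono[OF \<open>finite Q\<close>, of J] by simp
    qed
    then show ?thesis by blast
  qed
qed

section \<open>Bounds on distances along walks\<close>

locale bounds =
  fixes \<delta> K c :: nat
  assumes K1: "1 \<le> K" and K\<delta>: "K \<le> \<delta>" and c: "2 * \<delta> + K \<le> c"
begin

text \<open>If \<^term>\<open>w\<close> lists the lengths of the steps of a walk from \<open>x\<close> to \<open>y\<close>, then triangle inequality
  and perimeter bound force \<open>lo w \<le> d x y \<le> up w\<close>.\<close>

fun up lo :: "nat list \<Rightarrow> int" where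
  "up [] = 0"
| "up (a # w) = min (up w + int a) (int c - int a - lo w)"
| "lo [] = 0"
| "lo (a # w) = max (lo w - int a) (int a - up w)"

text \<open>A closed walk joins points at distance 0, so it needs
  \<open>lo w \<le> 0 \<le> up w\<close>; the second half holds for all words with labels up to
  \<delta>.\<close>

definition good :: "nat list \<Rightarrow> bool" where
  "good w \<longleftrightarrow> lo w \<le> 0 \<and> (odd (sum_list w) \<longrightarrow> 2 * K + 1 \<le> sum_list w)"

text \<open>The last two inequalities make the empty word neutral for concatenation: they are the
  base case of \<open>up_lo_append\<close>.\<close>

lemma up_lo_bounds:
  assumes "set w \<subseteq> {..\<delta>}"
  shows "0 \<le> up w" "lo w \<le> int \<delta>" "- up w \<le> lo w" "up w + lo w \<le> int c"
  using assms K\<delta> c by (induction w) (auto simp: min_def max_def split: if_splits)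

text \<open>The two halves act like two sides of a triangle of which only bounds are known, so a
  word may be cut anywhere. The formulas are symmetric in \<open>u\<close> and \<open>v\<close>,
  whence invariance under reversal and rotation.\<close>

lemma up_lo_append:
  assumes "set u \<subseteq> {..\<delta>}" "set v \<subseteq> {..\<delta>}"
  shows "up (u @ v) = min (up u + up v) (int c - lo u - lo v)"
    and "lo (u @ v) = max (lo u - up v) (lo v - up u)"
  using assms(1) up_lo_bounds[OF assms(2)]
  by (induction u) (auto simp: min_def max_def split: if_splits)

lemma up_lo_single: 
  assumes "a \<le> \<delta>"
  shows "up [a] = int a" "lo [a] = int a"
  using assms c by auto

lemma up_lo_rev:
  assumes "set w \<subseteq> {..\<delta>}"
  shows "up (rev w) = up w \<and> lo (rev w) = lo w"
  using assms
proof (induction w)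
  case (Cons a w)
  have "a \<le> \<delta>" "set (rev w) \<subseteq> {..\<delta>}" "set [a] \<subseteq> {..\<delta>}" using Cons.prems by auto
  with Cons show ?case
    using up_lo_append[of "rev w" "[a]"] up_lo_single[of a] by (simp del: up.simps(2) lo.simps(2)) simp
qed simp

lemma up_le_sum: "up w \<le> int (sum_list w)"
  by (induction w) auto

text \<open>The perimeter branch of \<open>up\<close> is at least
  \<open>c - \<delta> - \<delta>\<close>, hence at least \<open>K\<close>; below \<open>K\<close>
  only the sum branch is taken.\<close>

lemma up_eq_sum:
  assumes "set w \<subseteq> {..\<delta>}" "up w < int K"
  shows "up w = int (sum_list w)"
  using assms
proof (induction w)
  case (Cons a w)
  have "lo w \<le> int \<delta>" "a \<le> \<delta>" using Cons.prems up_lo_bounds[of w] by auto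
  then have "int K \<le> int c - int a - lo w" using c by linarith
  then have "up (a # w) = up w + int a" using Cons.prems by auto
  then show ?case using Cons by auto
qed simp

lemma up_pos:
  assumes "set w \<subseteq> {1..\<delta>}" "w \<noteq> []"
  shows "1 \<le> up w"
proof (cases w)
  case (Cons a v)
  have "set v \<subseteq> {..\<delta>}" "1 \<le> a" "a \<le> \<delta>" using assms Cons by auto
  then have "0 \<le> up v" "lo v \<le> int \<delta>" using up_lo_bounds[of v] by auto
  then show ?thesis using Cons \<open>1 \<le> a\<close> \<open>a \<le> \<delta>\<close> c K1 by auto
qed (use assms in simp)

text \<open>The guaranteed improvement is half a unit per step, hence the factor 2. Each bound at a
  step depends on the other one before it, so both go through one induction. From length
  \<open>2 * \<delta> + 1\<close> on, the lower bound is trivial.\<close>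

lemma long_word_bounds:
  assumes "set w \<subseteq> {1..\<delta>}"
  shows "min (int (length w)) (2 * int \<delta>) \<le> 2 * up w \<and>
    2 * lo w \<le> max 0 (2 * int \<delta> + 1 - int (length w))"
  using assms
proof (induction w)
  case (Cons a w)
  have "1 \<le> a" "a \<le> \<delta>" "set w \<subseteq> {1..\<delta>}" using Cons.prems by auto
  with Cons.IH show ?case using c K1 K\<delta>
    by (auto simp: min_def max_def split: if_splits)
qed simp

lemma good_long:
  assumes "set w \<subseteq> {1..\<delta>}" "2 * \<delta> < length w"
  shows "good w"
proof -
  have "lo w \<le> 0" using long_word_bounds[OF assms(1)] assms(2) by auto
  moreover have "length w \<le> sum_list w"
    using assms(1) by (induction w) auto
  ultimately show ?thesis using assms(2) K\<delta> by (auto simp: good_def)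
qed

lemma good_rotate:
  assumes "set u \<subseteq> {..\<delta>}" "set v \<subseteq> {..\<delta>}" "good (u @ v)"
  shows "good (v @ u)"
  using assms up_lo_append[OF assms(1,2)] up_lo_append[OF assms(2,1)]
  by (auto simp: good_def add.commute)

lemma good_zero:
  assumes "set w \<subseteq> {..\<delta>}" "good w"
  shows "good (0 # w)"
  using assms up_lo_bounds[OF assms(1)] by (auto simp: good_def)

text \<open>Both words have \<open>t\<close> between their bounds, so neither lower bound exceeds
  the other upper bound. If the glued word is odd, one of the words with \<open>t\<close> is odd,
  and replacing \<open>t\<close> by the other half does not decrease the sum.\<close>

lemma good_glue:
  assumes w: "set u \<subseteq> {..\<delta>}" "set v \<subseteq> {..\<delta>}" and g: "good (t # u)" "good (t # v)"
  shows "good (u @ v)"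
proof -
  have b: "lo u \<le> int t" "int t \<le> up u" "lo v \<le> int t" "int t \<le> up v"
    using g by (auto simp: good_def)
  have s: "t \<le> sum_list u" "t \<le> sum_list v"
    using b up_le_sum[of u] up_le_sum[of v] by linarith+
  have "2 * K + 1 \<le> sum_list (u @ v)" if "odd (sum_list (u @ v))"
  proof (cases "odd (sum_list (t # u))")
    case True
    then have "2 * K + 1 \<le> sum_list (t # u)" using g by (simp add: good_def)
    then show ?thesis using s by simp
  next
    case False
    then have "odd (sum_list (t # v))" using that by simp
    then have "2 * K + 1 \<le> sum_list (t # v)" using g by (simp add: good_def)
    then show ?thesis using s by simp
  qed
  then show ?thesis using b up_lo_append[OF w] by (auto simp: good_def)
qed

lemma good_swap_edge:
  assumes "s \<le> \<delta>"
  shows "good [s, s]"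
  using assms c by (auto simp: good_def)

end

section \<open>Walks\<close>

inductive walk :: "('v \<Rightarrow> 'v \<Rightarrow> nat \<Rightarrow> bool) \<Rightarrow> 'v \<Rightarrow> nat list \<Rightarrow> 'v \<Rightarrow> bool" for R where
  Nil: "walk R x [] x"
| Cons: "R x y a \<Longrightarrow> walk R y w z \<Longrightarrow> walk R x (a # w) z"

inductive_simps walk_Nil [simp]: "walk R x [] y"
inductive_simps walk_Cons: "walk R x (a # w) y"

lemma walk_append: "walk R x (u @ v) z \<longleftrightarrow> (\<exists>y. walk R x u y \<and> walk R y v z)"
  by (induction u arbitrary: x) (auto simp: walk_Cons)

lemma walk_rev:
  assumes "\<And>x y a. R x y a \<Longrightarrow> R y x a" "walk R x w y"
  shows "walk R y (rev w) x"
  using assms(2)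
proof (induction rule: walk.induct)
  case (Cons x y a w z)
  then show ?case using assms(1) by (auto simp: walk_append walk_Cons)
qed auto

lemma walk_map:
  assumes "\<And>x y a. R x y a \<Longrightarrow> S (h x) (h y) a" "walk R x w y"
  shows "walk S (h x) w (h y)"
  using assms(2) by induction (auto intro: walk.intros assms(1))

lemma walk_labels:
  assumes "walk R x w y" "\<And>x y a. R x y a \<Longrightarrow> a \<in> T"
  shows "set w \<subseteq> T"
  using assms by induction auto

section \<open>Completion to a metric space\<close>

text \<open>Triples may be degenerate: their perimeter is twice a distance, so it is even and at
  most \<open>2 * \<delta>\<close>, which is harmless as long as
  \<open>2 * \<delta> \<le> c\<close>.\<close>

definition admissible :: "nat \<Rightarrow> nat \<Rightarrow> nat \<Rightarrow> 'v set \<Rightarrow> ('v \<Rightarrow> 'v \<Rightarrow> nat) \<Rightarrow> bool" where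
  "admissible \<delta> K c V d \<longleftrightarrow>
     (\<forall>x\<in>V. \<forall>y\<in>V. d x y = d y x \<and> (d x y = 0 \<longleftrightarrow> x = y) \<and> d x y \<le> \<delta>) \<and>
     (\<forall>x\<in>V. \<forall>y\<in>V. \<forall>z\<in>V. d x z \<le> d x y + d y z \<and> d x y + d y z + d x z \<le> c \<and>
        (odd (d x y + d y z + d x z) \<longrightarrow> 2 * K + 1 \<le> d x y + d y z + d x z))"

lemma admissibleD:
  assumes "admissible \<delta> K c V d" "x \<in> V" "y \<in> V"
  shows "d x y = d y x" "d x y = 0 \<longleftrightarrow> x = y" "d x y \<le> \<delta>"
  using bspec[OF bspec[OF conjunct1[OF assms(1)[unfolded admissible_def]] assms(2)] assms(3)]
  by - (elim conjE, assumption)+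

lemma admissible_triangleD:
  assumes "admissible \<delta> K c V d" "x \<in> V" "y \<in> V" "z \<in> V"
  shows "d x z \<le> d x y + d y z" "d x y + d y z + d x z \<le> c"
    "odd (d x y + d y z + d x z) \<longrightarrow> 2 * K + 1 \<le> d x y + d y z + d x z"
  using bspec[OF bspec[OF bspec[OF conjunct2[OF assms(1)[unfolded admissible_def]] assms(2)] assms(3)] assms(4)]
  by - (elim conjE, assumption)+

locale good_graph = bounds +
  fixes R :: "'v \<Rightarrow> 'v \<Rightarrow> nat \<Rightarrow> bool"
  assumes sym: "R x y a \<Longrightarrow> R y x a"
    and label: "R x y a \<Longrightarrow> a \<in> {1..\<delta>}"
    and good_closed: "walk R x w x \<Longrightarrow> good w"
begin

text \<open>Adjoining \<delta> here and 0 in \<open>LO\<close>, and cutting off values beyond them,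
  makes \<open>Min\<close> and \<open>Max\<close> range over finite nonempty sets; pairs not joined
  by a walk get the trivial bounds.\<close>

definition UP :: "'v \<Rightarrow> 'v \<Rightarrow> int" where
  "UP x y = Min {u. u = int \<delta> \<or> u \<le> int \<delta> \<and> (\<exists>w. walk R x w y \<and> u = up w)}"

definition LO :: "'v \<Rightarrow> 'v \<Rightarrow> int" where
  "LO x y = Max {u. u = 0 \<or> 0 \<le> u \<and> (\<exists>w. walk R x w y \<and> u = lo w)}"

lemma walk_word: "walk R x w y \<Longrightarrow> set w \<subseteq> {1..\<delta>}"
  using walk_labels[of R x w y] label by blast

lemma walk_word0: "walk R x w y \<Longrightarrow> set w \<subseteq> {..\<delta>}"
  using walk_word[of x w y] by force

lemma finite_UP: "finite {u. u = int \<delta> \<or> u \<le> int \<delta> \<and> (\<exists>w. walk R x w y \<and> u = up w)}"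
  by (rule finite_subset[of _ "{0..int \<delta>}"]) (auto dest!: walk_word0 up_lo_bounds(1))

lemma finite_LO: "finite {u. u = 0 \<or> 0 \<le> u \<and> (\<exists>w. walk R x w y \<and> u = lo w)}"
  by (rule finite_subset[of _ "{0..int \<delta>}"]) (auto dest!: walk_word0 up_lo_bounds(2))

lemma UP_cases:
  obtains "UP x y = int \<delta>" | w where "walk R x w y" "UP x y = up w" "UP x y \<le> int \<delta>"
  using Min_in[OF finite_UP[of x y]] unfolding UP_def[symmetric] by blast

lemma LO_cases:
  obtains "LO x y = 0" | w where "walk R x w y" "LO x y = lo w" "0 \<le> LO x y"
  using Max_in[OF finite_LO[of x y]] unfolding LO_def[symmetric] by blast

lemma UP_le_delta: "UP x y \<le> int \<delta>"
  unfolding UP_def using finite_UP by (rule Min_le) simp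

lemma LO_ge_0: "0 \<le> LO x y"
  unfolding LO_def using finite_LO by (rule Max_ge) simp

lemma UP_le_up: assumes "walk R x w y" shows "UP x y \<le> up w"
proof (cases "up w \<le> int \<delta>")
  case True
  show ?thesis unfolding UP_def using finite_UP by (rule Min_le) (use assms True in auto)
qed (use UP_le_delta[of x y] in linarith)

lemma LO_ge_lo: assumes "walk R x w y" shows "lo w \<le> LO x y"
proof (cases "0 \<le> lo w")
  case True
  show ?thesis unfolding LO_def using finite_LO by (rule Max_ge) (use assms True in auto)
qed (use LO_ge_0[of x y] in linarith)

lemma LO_le_delta: "LO x y \<le> int \<delta>"
  by (rule LO_cases[of x y]) (auto dest: walk_word0 up_lo_bounds(2))

lemma UP_ge_0: "0 \<le> UP x y"
  by (rule UP_cases[of x y]) (auto dest: walk_word0 up_lo_bounds(1))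

lemma UP_le_sym: "UP y x \<le> UP x y"
proof (rule UP_cases[of x y])
  fix w assume w: "walk R x w y" "UP x y = up w"
  then show ?thesis using UP_le_up[OF walk_rev[OF sym w(1)]] up_lo_rev[OF walk_word0[OF w(1)]] by simp
qed (use UP_le_delta in simp)

lemma UP_sym: "UP x y = UP y x"
  by (intro antisym UP_le_sym)

lemma LO_le_sym: "LO x y \<le> LO y x"
proof (rule LO_cases[of x y])
  fix w assume w: "walk R x w y" "LO x y = lo w"
  then show ?thesis using LO_ge_lo[OF walk_rev[OF sym w(1)]] up_lo_rev[OF walk_word0[OF w(1)]] by simp
qed (use LO_ge_0 in simp)

lemma LO_sym: "LO x y = LO y x"
  by (intro antisym LO_le_sym)

lemma UP_triangle: "UP x z \<le> UP x y + UP y z"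
proof (cases rule: UP_cases[of x y])
  case (2 u)
  show ?thesis
  proof (cases rule: UP_cases[of y z])
    case (2 v)
    then have "walk R x (u @ v) z" using \<open>walk R x u y\<close> by (auto simp: walk_append)
    from UP_le_up[OF this] show ?thesis
      using up_lo_append[of u v] 2 \<open>UP x y = up u\<close> walk_word0 \<open>walk R x u y\<close> by fastforce
  qed (use UP_le_delta[of x z] UP_ge_0[of x y] in linarith)
qed (use UP_le_delta[of x z] UP_ge_0[of y z] in linarith)

lemma UP_LO_LO: "UP x z + LO x y + LO y z \<le> int c"
proof (cases rule: LO_cases[of x y])
  case (2 u)
  show ?thesis
  proof (cases rule: LO_cases[of y z])
    case (2 v)
    then have "walk R x (u @ v) z" using \<open>walk R x u y\<close> by (auto simp: walk_append)
    from UP_le_up[OF this] show ?thesis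
      using up_lo_append[of u v] 2 \<open>LO x y = lo u\<close> walk_word0 \<open>walk R x u y\<close> by fastforce
  qed (use UP_le_delta[of x z] LO_le_delta[of x y] c in linarith)
qed (use UP_le_delta[of x z] LO_le_delta[of y z] c in linarith)

lemma LO_UP: "LO x y \<le> LO x z + UP y z"
proof (cases rule: LO_cases[of x y])
  case (2 u)
  show ?thesis
  proof (cases rule: UP_cases[of y z])
    case (2 v)
    then have "walk R x (u @ v) z" using \<open>walk R x u y\<close> by (auto simp: walk_append)
    from LO_ge_lo[OF this] show ?thesis
      using up_lo_append[of u v] 2 \<open>LO x y = lo u\<close> walk_word0 \<open>walk R x u y\<close> by fastforce
  qed (use LO_le_delta[of x y] LO_ge_0[of x z] in linarith)
qed (use LO_ge_0[of x z] UP_ge_0[of y z] in linarith)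

text \<open>Going along a walk that attains \<open>LO\<close> and back along one that attains
  \<open>UP\<close> is a closed walk, and its goodness contains this inequality.\<close>

lemma LO_le_UP: "LO x y \<le> UP x y"
proof (cases rule: LO_cases[of x y])
  case (2 u)
  show ?thesis
  proof (cases rule: UP_cases[of x y])
    case (2 v)
    then have "walk R x (u @ rev v) x"
      using \<open>walk R x u y\<close> walk_rev[OF sym 2(1)] by (auto simp: walk_append)
    from good_closed[OF this] show ?thesis
      using up_lo_append[of u "rev v"] up_lo_rev[of v] 2 \<open>LO x y = lo u\<close> walk_word0 \<open>walk R x u y\<close>
      by (fastforce simp: good_def)
  qed (use LO_le_delta[of x y] in linarith)
qed (use UP_ge_0[of x y] in linarith)

text \<open>The middle value is at least \<^term>\<open>K\<close>, so that it creates no short odd triangle, and at least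
  \<open>\<delta> / 2\<close>, so that two of it satisfy the triangle inequality with any third side.\<close>

definition mid :: int where "mid = max (int K) ((int \<delta> + 1) div 2)"

definition cdist :: "'v \<Rightarrow> 'v \<Rightarrow> int" where
  "cdist x y = max (LO x y) (min mid (UP x y))"

lemma mid: "int K \<le> mid" "int \<delta> \<le> 2 * mid" "mid \<le> int \<delta>" "int \<delta> + 2 * mid \<le> int c"
  using K1 K\<delta> c by (auto simp: mid_def)

lemma cdist_cases:
  obtains "cdist x y < mid" "cdist x y = UP x y" | "cdist x y = mid" "mid \<le> UP x y" "LO x y \<le> mid"
  | "mid < cdist x y" "cdist x y = LO x y"
proof -
  have "cdist x y < mid \<and> cdist x y = UP x y \<or> cdist x y = mid \<and> mid \<le> UP x y \<and> LO x y \<le> mid \<or>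
    mid < cdist x y \<and> cdist x y = LO x y"
    using LO_le_UP[of x y] unfolding cdist_def by linarith
  then show ?thesis using that by blast
qed

lemma cdist_bounds: "LO x y \<le> cdist x y" "cdist x y \<le> UP x y"
  using LO_le_UP[of x y] by (auto simp: cdist_def)

lemma cdist_sym: "cdist x y = cdist y x"
  by (simp add: cdist_def UP_sym[of x y] LO_sym[of x y])

lemma cdist_range: "0 \<le> cdist x y" "cdist x y \<le> int \<delta>"
  using cdist_bounds[of x y] LO_ge_0[of x y] UP_le_delta[of x y] by linarith+

lemma cdist_self: "cdist x x = 0"
  using UP_le_up[OF walk.Nil, of x] cdist_bounds[of x x] cdist_range[of x x] by simp

lemma cdist_pos: assumes "x \<noteq> y" shows "1 \<le> cdist x y"
proof -
  have "1 \<le> UP x y"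
  proof (cases rule: UP_cases[of x y])
    case 1
    then show ?thesis using K1 K\<delta> by linarith
  next
    case (2 w)
    then have "w \<noteq> []" using assms by auto
    then show ?thesis using up_pos[OF walk_word[OF 2(1)]] 2 by simp
  qed
  then show ?thesis using mid(1) K1 by (auto simp: cdist_def)
qed

lemma cdist_edge: assumes "R x y a" shows "cdist x y = int a"
proof -
  have w: "walk R x [a] y" using assms by (auto simp: walk_Cons)
  have "a \<le> \<delta>" using label[OF assms] by simp
  then show ?thesis
    using UP_le_up[OF w] LO_ge_lo[OF w] up_lo_single[of a] cdist_bounds[of x y] by linarith
qed

text \<open>Two summands of at least \<open>mid\<close> reach \<delta>; two below \<open>mid\<close>
  are upper bounds, and \<open>UP_triangle\<close> applies. With one of each kind only
  \<open>cdist x z > mid\<close> matters; it is then a lower bound, and \<open>LO_UP\<close>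
  applies.\<close>

lemma cdist_triangle: "cdist x z \<le> cdist x y + cdist y z"
  using UP_triangle[of x z y] LO_UP[of x z y] LO_UP[of z x y]
    LO_sym[of x z] LO_sym[of z y] UP_sym[of z y] UP_sym[of x y]
    cdist_bounds[of x z] cdist_bounds[of x y] cdist_bounds[of y z]
    cdist_range[of x z] cdist_range[of x y] cdist_range[of y z] mid
  by (rule_tac cdist_cases[of x z]; rule_tac cdist_cases[of x y]; rule_tac cdist_cases[of y z]; linarith)

text \<open>Two sides of at most \<open>mid\<close> leave room for any third. Otherwise two sides
  exceed \<open>mid\<close> and equal their lower bounds, which limits the third by
  \<open>UP_LO_LO\<close>.\<close>

lemma cdist_perimeter: "cdist x y + cdist y z + cdist x z \<le> int c"
  using UP_LO_LO[of x z y] UP_LO_LO[of y z x] UP_LO_LO[of x y z]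
    LO_sym[of x y] LO_sym[of y z]
    cdist_bounds[of x z] cdist_bounds[of x y] cdist_bounds[of y z]
    cdist_range[of x z] cdist_range[of x y] cdist_range[of y z] mid
  by (rule_tac cdist_cases[of x z]; rule_tac cdist_cases[of x y]; rule_tac cdist_cases[of y z]; linarith)

lemma cdist_small:
  assumes "cdist x y < int K"
  obtains w where "walk R x w y" "cdist x y = int (sum_list w)"
proof -
  have 1: "cdist x y = UP x y"
    using assms mid by (cases rule: cdist_cases[of x y]) linarith+
  show ?thesis
  proof (cases rule: UP_cases[of x y])
    case 1
    then show ?thesis using \<open>cdist x y = UP x y\<close> assms K\<delta> by linarith
  next
    case (2 w)
    then show ?thesis using that[OF 2(1)] 1 up_eq_sum[OF walk_word0[OF 2(1)]] assms by simp
  qed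
qed

text \<open>A side of at least \<open>K\<close> forces perimeter at least \<open>2 * K\<close>, and
  oddness adds the missing unit. Sides below \<open>K\<close> are sums along walks, and three of
  them close up to a good walk with the same sum.\<close>

lemma cdist_odd_perimeter:
  assumes "odd (cdist x y + cdist y z + cdist x z)"
  shows "2 * int K + 1 \<le> cdist x y + cdist y z + cdist x z"
proof -
  let ?p = "cdist x y + cdist y z + cdist x z"
  have "2 * cdist x y \<le> ?p" "2 * cdist y z \<le> ?p" "2 * cdist x z \<le> ?p"
    using cdist_triangle[of x y z] cdist_triangle[of y z x] cdist_triangle[of x z y]
      cdist_sym[of z y] cdist_sym[of y x] by linarith+
  moreover have "?p \<noteq> 2 * int K" using assms by (metis dvd_triv_left)
  moreover have ?thesis if small: "cdist x y < int K" "cdist y z < int K" "cdist x z < int K"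
  proof -
    obtain u v w where w: "walk R x u y" "cdist x y = int (sum_list u)"
      "walk R y v z" "cdist y z = int (sum_list v)" "walk R x w z" "cdist x z = int (sum_list w)"
      using small by (metis cdist_small)
    have "walk R x (u @ v @ rev w) x"
      using w walk_rev[OF sym w(5)] by (auto simp: walk_append)
    from good_closed[OF this, unfolded good_def, THEN conjunct2] have "odd (sum_list (u @ v @ rev w)) \<longrightarrow> 2 * K + 1 \<le> sum_list (u @ v @ rev w)"
      .
    moreover have eq: "?p = int (sum_list (u @ v @ rev w))" using w by (simp add: sum_list_rev)
    ultimately show ?thesis using assms by (simp only: eq even_of_nat) simp
  qed
  ultimately show ?thesis by linarith
qed

theorem completion:
  "\<exists>d. (\<forall>x y a. R x y a \<longrightarrow> d x y = a) \<and> admissible \<delta> K c UNIV d"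
proof (intro exI[of _ "\<lambda>x y. nat (cdist x y)"] conjI allI impI)
  show "nat (cdist x y) = a" if "R x y a" for x y a using cdist_edge[OF that] by simp
  have p: "nat (cdist x y) + nat (cdist y z) + nat (cdist x z) = nat (cdist x y + cdist y z + cdist x z)" for x y z
    using cdist_range[of x y] cdist_range[of y z] cdist_range[of x z] by simp
  have zero: "nat (cdist x y) = 0 \<longleftrightarrow> x = y" for x y
    using cdist_self[of x] cdist_pos[of x y] by (cases "x = y") auto
  have le: "nat (cdist x y) \<le> \<delta>" for x y using cdist_range[of x y] by simp
  have tri: "nat (cdist x z) \<le> nat (cdist x y) + nat (cdist y z)" for x y z
    using cdist_triangle[of x z y] cdist_range[of x y] cdist_range[of y z] by simp
  have per: "nat (cdist x y + cdist y z + cdist x z) \<le> c" for x y z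
    using cdist_perimeter[of x y z] by simp
  have od: "2 * K + 1 \<le> nat (cdist x y + cdist y z + cdist x z)"
    if "odd (nat (cdist x y + cdist y z + cdist x z))" for x y z
    using cdist_odd_perimeter[of x y z] cdist_range[of x y] cdist_range[of y z] cdist_range[of x z] that
    by (auto simp: even_nat_iff)
  have sy: "nat (cdist x y) = nat (cdist y x)" for x y by (simp add: cdist_sym[of x y])
  show "admissible \<delta> K c UNIV (\<lambda>x y. nat (cdist x y))"
    unfolding admissible_def p by (intro conjI ballI impI zero le tri per od sy)
qed

end

section \<open>The partite construction\<close>

lemma walk_meets:
  assumes "walk R x w y"
  shows "walk (\<lambda>x y t. R x y t \<and> \<not> Q x \<and> \<not> Q y) x w y \<or>
    (\<exists>u v s. w = u @ v \<and> Q s \<and> walk R x u s \<and> walk R s v y)"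
  using assms
proof (induction rule: walk.induct)
  case (Cons x y a w z)
  have w: "walk R x (a # w) z" using Cons.hyps by (rule walk.Cons)
  show ?case
  proof (cases "Q x")
    case True
    then show ?thesis using w by (intro disjI2 exI[of _ "[]"] exI[of _ "a # w"] exI[of _ x]) simp
  next
    case nQx: False
    from Cons.IH show ?thesis
    proof
      assume IH: "walk (\<lambda>x y t. R x y t \<and> \<not> Q x \<and> \<not> Q y) y w z"
      show ?thesis
      proof (cases "Q y")
        case True
        then show ?thesis using Cons.hyps
          by (intro disjI2 exI[of _ "[a]"] exI[of _ w] exI[of _ y]) (simp add: walk_Cons)
      next
        case False
        then show ?thesis using nQx IH Cons.hyps by (auto simp: walk_Cons)
      qed
    next
      assume "\<exists>u v s. w = u @ v \<and> Q s \<and> walk R y u s \<and> walk R s v z"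
      then obtain u v s where "w = u @ v" "Q s" "walk R y u s" "walk R s v z" by blast
      then show ?thesis using Cons.hyps(1)
        by (intro disjI2 exI[of _ "a # u"] exI[of _ v] exI[of _ s]) (auto intro: walk.Cons)
    qed
  qed
qed simp

section \<open>Walks inside an admissible space\<close>

context bounds
begin

lemma good_pair: "good [s, t] \<Longrightarrow> s = t"
  by (simp add: good_def)

text \<open>Soundness of the bounds: the first step cuts off a triangle. For parity, either this
  triangle or the remaining walk closed by \<open>d y z\<close> is odd, and what replaces its side
  \<open>d y z\<close> or its triangle path is never shorter.\<close>

lemma admissible_walk:
  assumes d: "admissible \<delta> K c V d" and w: "walk (\<lambda>x y t. x \<in> V \<and> y \<in> V \<and> t = d x y) x w y" and "x \<in> V"
  shows "y \<in> V \<and> lo w \<le> int (d x y) \<and> int (d x y) \<le> up w \<and>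
    (odd (sum_list w + d x y) \<longrightarrow> 2 * K + 1 \<le> sum_list w + d x y)"
  using w \<open>x \<in> V\<close>
proof (induction rule: walk.induct)
  case (Nil x)
  then show ?case using admissibleD(2)[OF d Nil Nil] by simp
next
  case (Cons x y a w z)
  then have IH: "z \<in> V" "lo w \<le> int (d y z)" "int (d y z) \<le> up w"
    "odd (sum_list w + d y z) \<Longrightarrow> 2 * K + 1 \<le> sum_list w + d y z" by auto
  have V: "x \<in> V" "y \<in> V" "z \<in> V" "a = d x y" using Cons IH by auto
  have t: "d x z \<le> a + d y z" "a \<le> d x z + d y z" "d y z \<le> a + d x z" "a + d y z + d x z \<le> c"
    "odd (a + d y z + d x z) \<longrightarrow> 2 * K + 1 \<le> a + d y z + d x z"
    using admissible_triangleD[OF d V(1-3)] admissible_triangleD(1)[OF d V(1,3,2)]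
      admissible_triangleD(1)[OF d V(2,1,3)] admissibleD(1)[OF d V(1,2)] admissibleD(1)[OF d V(2,3)] V(4)
    by simp_all
  have s: "d y z \<le> sum_list w" using IH(3) up_le_sum[of w] by linarith
  have "2 * K + 1 \<le> sum_list (a # w) + d x z" if o: "odd (sum_list (a # w) + d x z)"
  proof (cases "odd (sum_list w + d y z)")
    case True
    then show ?thesis using IH(4) t by simp
  next
    case False
    then have "odd (a + d y z + d x z)" using o by simp
    then show ?thesis using t s by simp
  qed
  then show ?case using IH t by auto
qed

lemma admissible_closed_good:
  assumes "admissible \<delta> K c V d" "walk (\<lambda>x y t. x \<in> V \<and> y \<in> V \<and> t = d x y) x w x"
  shows "good w"
proof (cases w)
  case Nil
  then show ?thesis by (simp add: good_def)
next
  case (Cons a v)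
  then have "x \<in> V" using assms(2) by (auto simp: walk_Cons)
  moreover have "d x x = 0" using admissibleD(2)[OF assms(1)] \<open>x \<in> V\<close> by simp
  ultimately show ?thesis using admissible_walk[OF assms] by (simp add: good_def)
qed

end

text \<open>In a graph given by a label function \<^term>\<open>l\<close>, the label \<open>0\<close> stands for a non-edge.\<close>

definition edges :: "'v set \<Rightarrow> ('v \<Rightarrow> 'v \<Rightarrow> nat) \<Rightarrow> 'v \<Rightarrow> 'v \<Rightarrow> nat \<Rightarrow> bool" where
  "edges V l x y t \<longleftrightarrow> x \<in> V \<and> y \<in> V \<and> t = l x y \<and> t \<noteq> 0"

text \<open>Copies of the ordered space on \<open>{..<n}\<close> with distance \<^term>\<open>d\<close>, as lists with increasing ranks. Ranks need
  not be injective; they are refined to a linear order only at the very end.\<close>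

definition emb :: "'v set \<Rightarrow> ('v \<Rightarrow> 'v \<Rightarrow> nat \<Rightarrow> bool) \<Rightarrow> ('v \<Rightarrow> nat) \<Rightarrow> nat \<Rightarrow> (nat \<Rightarrow> nat \<Rightarrow> nat) \<Rightarrow> 'v list \<Rightarrow> bool" where
  "emb V R \<rho> n d f \<longleftrightarrow> length f = n \<and> set f \<subseteq> V \<and>
     (\<forall>j<n. \<forall>i<j. \<rho> (f ! i) < \<rho> (f ! j) \<and> R (f ! i) (f ! j) (d i j))"

text \<open>The edge relation of a template may carry several labels per pair, which lets the complete
  structure of Ramsey's theorem serve as the first template.\<close>

locale template = bounds +
  fixes W :: "'w set" and S :: "'w \<Rightarrow> 'w \<Rightarrow> nat \<Rightarrow> bool" and \<rho> :: "'w \<Rightarrow> nat"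
    and a :: nat and dA :: "nat \<Rightarrow> nat \<Rightarrow> nat"
  assumes W_fin: "finite W" and S_sym: "S p q t \<Longrightarrow> S q p t" and S_irrefl: "\<not> S q q t"
    and S_label: "S p q t \<Longrightarrow> t \<in> {1..\<delta>}"
    and A: "admissible \<delta> K c {..<a} dA"
begin

text \<open>The pictures of the partite construction: the parts are the fibres of
  \<open>\<pi>\<close>, and they span no edges because \<open>S\<close> is irreflexive.\<close>

definition over :: "'v set \<Rightarrow> ('v \<Rightarrow> 'v \<Rightarrow> nat) \<Rightarrow> ('v \<Rightarrow> 'w) \<Rightarrow> bool" where
  "over V l \<pi> \<longleftrightarrow> finite V \<and> \<pi> ` V \<subseteq> W \<and> (\<forall>x\<in>V. \<forall>y\<in>V. l x y = l y x) \<and>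
     (\<forall>x\<in>V. \<forall>y\<in>V. l x y \<noteq> 0 \<longrightarrow> S (\<pi> x) (\<pi> y) (l x y))"

definition cliques :: "'v set \<Rightarrow> ('v \<Rightarrow> 'v \<Rightarrow> nat) \<Rightarrow> ('v \<Rightarrow> 'w) \<Rightarrow> 'w list \<Rightarrow> 'v list set" where
  "cliques V l \<pi> \<alpha> = {f. length f = a \<and> set f \<subseteq> V \<and> map \<pi> f = \<alpha> \<and> (\<forall>j<a. \<forall>i<j. l (f ! i) (f ! j) = dA i j)}"

lemma dA_sym: "i < a \<Longrightarrow> j < a \<Longrightarrow> dA i j = dA j i"
  and dA_zero: "i < a \<Longrightarrow> j < a \<Longrightarrow> dA i j = 0 \<longleftrightarrow> i = j"
  using admissibleD[OF A] by simp_all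

end

locale partite_step = template \<delta> K c W S \<rho> a dA
  for \<delta> K c :: nat and W :: "'w set" and S \<rho> a dA +
  fixes V :: "'v set" and l :: "'v \<Rightarrow> 'v \<Rightarrow> nat" and \<pi> :: "'v \<Rightarrow> 'w" and \<alpha> :: "'w list" and N :: nat
  assumes P: "over V l \<pi>" and \<alpha>: "emb W S \<rho> a dA \<alpha>"
begin

lemma l_sym: "x \<in> V \<Longrightarrow> y \<in> V \<Longrightarrow> l x y = l y x"
  and \<pi>_W: "x \<in> V \<Longrightarrow> \<pi> x \<in> W"
  and hom: "x \<in> V \<Longrightarrow> y \<in> V \<Longrightarrow> l x y \<noteq> 0 \<Longrightarrow> S (\<pi> x) (\<pi> y) (l x y)"
  and V_fin: "finite V"
  using P by (auto simp: over_def)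

lemma l_self: "x \<in> V \<Longrightarrow> y \<in> V \<Longrightarrow> \<pi> x = \<pi> y \<Longrightarrow> l x y = 0"
  using hom[of x y] S_irrefl by metis

definition idx :: "'w \<Rightarrow> nat" where "idx q = (SOME i. i < a \<and> \<alpha> ! i = q)"

lemma length_\<alpha>: "length \<alpha> = a"
  using \<alpha> by (auto simp: emb_def)

lemma \<alpha>_inj: "i < a \<Longrightarrow> j < a \<Longrightarrow> \<alpha> ! i = \<alpha> ! j \<Longrightarrow> i = j"
  using \<alpha> unfolding emb_def by (metis less_irrefl nat_neq_iff)

lemma idx: "q \<in> set \<alpha> \<Longrightarrow> idx q < a \<and> \<alpha> ! idx q = q"
  unfolding idx_def by (rule someI_ex) (use length_\<alpha> in \<open>auto simp: in_set_conv_nth\<close>)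

lemma idx_nth: "i < a \<Longrightarrow> idx (\<alpha> ! i) = i"
  using idx[of "\<alpha> ! i"] \<alpha>_inj length_\<alpha> by auto

lemma S_\<alpha>: "i < a \<Longrightarrow> j < a \<Longrightarrow> i \<noteq> j \<Longrightarrow> S (\<alpha> ! i) (\<alpha> ! j) (dA i j)"
  using \<alpha> S_sym dA_sym[of i j] unfolding emb_def by (metis linorder_neqE_nat)

definition D where "D = {x \<in> V. \<pi> x \<in> set \<alpha>}"

abbreviation "cl \<equiv> cliques V l \<pi> \<alpha>"
abbreviation "LL \<equiv> lines N cl"

text \<open>The embedding of \<open>D\<close> into its power given by a line: a moving coordinate
  holds the point itself, a constant one the vertex of the fixed clique in the same part.\<close>

definition tup :: "'v list option list \<Rightarrow> 'v \<Rightarrow> 'v list" where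
  "tup L x = map (\<lambda>z. case z of None \<Rightarrow> x | Some f \<Rightarrow> f ! idx (\<pi> x)) L"

definition tuples :: "'v list set" where
  "tuples = {xs. length xs = N \<and> xs \<noteq> [] \<and> set xs \<subseteq> D \<and> (\<forall>x\<in>set xs. \<pi> x = \<pi> (hd xs))}"

text \<open>Points outside \<^term>\<open>D\<close> get one copy for each combinatorial line \<^term>\<open>L\<close>; the copies are amalgamated
  freely over the power \<^term>\<open>tuples\<close> of \<^term>\<open>D\<close>.\<close>

definition V' :: "('v list + 'v list option list \<times> 'v) set" where
  "V' = Inl ` tuples \<union> Inr ` (LL \<times> (V - D))"

definition \<pi>' :: "'v list + 'v list option list \<times> 'v \<Rightarrow> 'w" where
  "\<pi>' p = (case p of Inl xs \<Rightarrow> \<pi> (hd xs) | Inr (L, x) \<Rightarrow> \<pi> x)"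

definition dA' where "dA' xs ys = dA (idx (\<pi> (hd xs))) (idx (\<pi> (hd ys)))"

text \<open>Coordinates at which the line is constant contribute the distance prescribed by \<^term>\<open>\<alpha>\<close>, and
  the label at the remaining ones is to be recovered.\<close>

definition tuple_label :: "'v list \<Rightarrow> 'v list \<Rightarrow> nat" where
  "tuple_label xs ys = (let T = (\<lambda>m. l (xs ! m) (ys ! m)) ` {..<N} - {dA' xs ys} in
     if T = {} then dA' xs ys else if is_singleton T then the_elem T else 0)"

definition mixed_label :: "'v list option list \<times> 'v \<Rightarrow> 'v list \<Rightarrow> nat" where
  "mixed_label p ys = (if \<exists>z\<in>D. tup (fst p) z = ys then l (snd p) (SOME z. z \<in> D \<and> tup (fst p) z = ys) else 0)"

definition l' where
  "l' p q = (case p of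
     Inl xs \<Rightarrow> (case q of Inl ys \<Rightarrow> tuple_label xs ys | Inr s \<Rightarrow> mixed_label s xs)
   | Inr r \<Rightarrow> (case q of Inl ys \<Rightarrow> mixed_label r ys
       | Inr s \<Rightarrow> if fst r = fst s then l (snd r) (snd s) else 0))"

definition copy :: "'v list option list \<Rightarrow> 'v \<Rightarrow> 'v list + 'v list option list \<times> 'v" where
  "copy L x = (if x \<in> D then Inl (tup L x) else Inr (L, x))"

lemma D_V: "x \<in> D \<Longrightarrow> x \<in> V" by (simp add: D_def)

lemma idx_D: "x \<in> D \<Longrightarrow> idx (\<pi> x) < a \<and> \<alpha> ! idx (\<pi> x) = \<pi> x"
  using idx by (auto simp: D_def)

lemma clique_nth:
  assumes "f \<in> cl" "i < a"
  shows "f ! i \<in> D" "\<pi> (f ! i) = \<alpha> ! i" "idx (\<pi> (f ! i)) = i"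
proof -
  have "length f = a" "set f \<subseteq> V" "map \<pi> f = \<alpha>" using assms by (auto simp: cliques_def)
  then show "\<pi> (f ! i) = \<alpha> ! i" "f ! i \<in> D" 
    using assms(2) by (auto simp: D_def)
  then show "idx (\<pi> (f ! i)) = i" using idx_nth[OF assms(2)] by simp
qed

lemma clique_label:
  assumes "f \<in> cl" "i < a" "j < a"
  shows "l (f ! i) (f ! j) = dA i j"
proof (cases i j rule: linorder_cases)
  case equal
  then show ?thesis
    using l_self[of "f ! i" "f ! i"] clique_nth[OF assms(1,2)] D_V dA_zero[of i i] assms by auto
next
  case greater
  then have "l (f ! j) (f ! i) = dA j i" using assms by (auto simp: cliques_def)
  then show ?thesis
    using l_sym clique_nth(1)[OF assms(1,2)] clique_nth(1)[OF assms(1,3)] D_V dA_sym assms by metis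
qed (use assms in \<open>auto simp: cliques_def\<close>)

lemma line_entry:
  assumes "L \<in> LL" "z \<in> set L"
  shows "z = None \<or> (\<exists>f\<in>cl. z = Some f)"
  using assms by (auto simp: lines_def)

lemma line_None:
  assumes "L \<in> LL"
  obtains m where "m < N" "L ! m = None"
  using assms by (auto simp: lines_def in_set_conv_nth)

lemma tup_nth: "L \<in> LL \<Longrightarrow> m < N \<Longrightarrow> tup L x ! m = (case L ! m of None \<Rightarrow> x | Some f \<Rightarrow> f ! idx (\<pi> x))"
  by (simp add: tup_def lines_def)

lemma tup_inj: assumes "L \<in> LL" "tup L x = tup L y" shows "x = y"
proof -
  obtain m where "m < N" "L ! m = None" using line_None[OF assms(1)] .
  then show ?thesis using tup_nth[OF assms(1), of m] assms(2) by (metis option.simps(4))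
qed

lemma tup_entry:
  assumes "L \<in> LL" "x \<in> D" "y \<in> set (tup L x)"
  shows "y \<in> D \<and> \<pi> y = \<pi> x"
proof -
  obtain z where z: "z \<in> set L" "y = (case z of None \<Rightarrow> x | Some f \<Rightarrow> f ! idx (\<pi> x))"
    using assms(3) by (auto simp: tup_def)
  from line_entry[OF assms(1) z(1)] show ?thesis
    using z assms(2) clique_nth idx_D[OF assms(2)] by auto
qed

lemma tup_tuples:
  assumes "L \<in> LL" "x \<in> D" 
  shows "tup L x \<in> tuples" "\<pi> (hd (tup L x)) = \<pi> x"
proof -
  have "L \<noteq> []" "length L = N" using assms by (auto simp: lines_def)
  then have ne: "tup L x \<noteq> []" "length (tup L x) = N" by (auto simp: tup_def)
  then show h: "\<pi> (hd (tup L x)) = \<pi> x" using tup_entry[OF assms] by simp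
  show "tup L x \<in> tuples" using ne tup_entry[OF assms] h by (auto simp: tuples_def)
qed

lemma copy_V': "L \<in> LL \<Longrightarrow> x \<in> V \<Longrightarrow> copy L x \<in> V'"
  using tup_tuples by (auto simp: copy_def V'_def)

lemma \<pi>'_copy: "L \<in> LL \<Longrightarrow> \<pi>' (copy L x) = \<pi> x"
  using tup_tuples by (auto simp: copy_def \<pi>'_def)

lemma copy_inj: "L \<in> LL \<Longrightarrow> copy L x = copy L y \<Longrightarrow> x = y"
  using tup_inj by (auto simp: copy_def split: if_splits)

text \<open>Moving coordinates show \<open>l x y\<close>, constant ones the distance
  \<open>?d\<close>. Deleting \<open>?d\<close> leaves \<open>l x y\<close> alone or nothing; as
  some coordinate moves, nothing is left only if \<open>l x y = ?d\<close>.\<close>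

lemma tuple_label_tup:
  assumes L: "L \<in> LL" and x: "x \<in> D" and y: "y \<in> D"
  shows "tuple_label (tup L x) (tup L y) = l x y"
proof -
  let ?d = "dA (idx (\<pi> x)) (idx (\<pi> y))"
  obtain m where m: "m < N" "L ! m = None" using line_None[OF L] .
  have e: "l (tup L x ! m) (tup L y ! m) \<in> {l x y, ?d}" if "m < N" for m
  proof -
    have "L ! m \<in> set L" using that L by (auto simp: lines_def)
    from line_entry[OF L this] show ?thesis
      using tup_nth[OF L that] clique_label idx_D x y by auto
  qed
  moreover have "l (tup L x ! m) (tup L y ! m) = l x y" using tup_nth[OF L m(1)] m by simp
  ultimately have "(\<lambda>m. l (tup L x ! m) (tup L y ! m)) ` {..<N} - {?d} = {l x y} - {?d}"
    using m(1) by (auto intro: rev_image_eqI)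
  then show ?thesis
    using tup_tuples[OF L x] tup_tuples[OF L y] 
    by (auto simp: tuple_label_def dA'_def Let_def insert_Diff_if)
qed

lemma mixed_label_tup:
  assumes L: "L \<in> LL" and y: "y \<in> D"
  shows "mixed_label (L, x) (tup L y) = l x y"
proof -
  have "(SOME z. z \<in> D \<and> tup L z = tup L y) = y"
    by (rule some_equality) (use y tup_inj[OF L] in auto)
  then show ?thesis using y by (auto simp: mixed_label_def)
qed

lemma l'_copy:
  assumes "L \<in> LL" "x \<in> V" "y \<in> V"
  shows "l' (copy L x) (copy L y) = l x y"
  using tuple_label_tup[OF assms(1), of x y] mixed_label_tup[OF assms(1), of y x]
    mixed_label_tup[OF assms(1), of x y] l_sym[OF assms(2,3)]
  by (simp add: copy_def l'_def)

lemma tuples_nth: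
  assumes "xs \<in> tuples" "m < N"
  shows "xs ! m \<in> D" "\<pi> (xs ! m) = \<pi> (hd xs)"
proof -
  have "xs ! m \<in> set xs" using assms by (simp add: tuples_def)
  then show "xs ! m \<in> D" "\<pi> (xs ! m) = \<pi> (hd xs)" using assms(1) unfolding tuples_def by blast+
qed

lemma hd_tuples: assumes "xs \<in> tuples" shows "hd xs \<in> D"
proof -
  have "xs \<noteq> []" "set xs \<subseteq> D" using assms by (simp_all add: tuples_def)
  then show ?thesis using hd_in_set by blast
qed

lemma tuple_label_sym:
  assumes "xs \<in> tuples" "ys \<in> tuples"
  shows "tuple_label xs ys = tuple_label ys xs"
proof -
  have "dA' xs ys = dA' ys xs"
    unfolding dA'_def
    using idx_D[OF hd_tuples[OF assms(1)]] idx_D[OF hd_tuples[OF assms(2)]] by (intro dA_sym) simp_all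
  moreover have "(\<lambda>m. l (xs ! m) (ys ! m)) ` {..<N} = (\<lambda>m. l (ys ! m) (xs ! m)) ` {..<N}"
    using tuples_nth(1)[OF assms(1)] tuples_nth(1)[OF assms(2)] by (intro image_cong refl l_sym D_V) simp_all
  ultimately show ?thesis by (simp only: tuple_label_def)
qed

lemma l'_sym:
  assumes "p \<in> V'" "q \<in> V'"
  shows "l' p q = l' q p"
  using assms unfolding V'_def
  by (elim UnE imageE SigmaE) (simp_all add: l'_def tuple_label_sym l_sym)

lemma tuple_label_S:
  assumes "xs \<in> tuples" "ys \<in> tuples" "tuple_label xs ys \<noteq> 0"
  shows "S (\<pi> (hd xs)) (\<pi> (hd ys)) (tuple_label xs ys)"
proof -
  let ?T = "(\<lambda>m. l (xs ! m) (ys ! m)) ` {..<N} - {dA' xs ys}"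
  have i: "idx (\<pi> (hd xs)) < a" "\<alpha> ! idx (\<pi> (hd xs)) = \<pi> (hd xs)"
    "idx (\<pi> (hd ys)) < a" "\<alpha> ! idx (\<pi> (hd ys)) = \<pi> (hd ys)"
    using idx_D hd_tuples assms by auto
  show ?thesis
  proof (cases "?T = {}")
    case True
    then have e: "tuple_label xs ys = dA' xs ys" by (simp add: tuple_label_def)
    then have "idx (\<pi> (hd xs)) \<noteq> idx (\<pi> (hd ys))"
      using assms(3) dA_zero i by (auto simp: dA'_def)
    then show ?thesis using S_\<alpha>[OF i(1,3)] i e by (simp add: dA'_def)
  next
    case False
    then have "is_singleton ?T" "tuple_label xs ys = the_elem ?T"
      using assms(3) by (auto simp: tuple_label_def Let_def split: if_splits)
    then have "tuple_label xs ys \<in> ?T" by (metis is_singleton_the_elem singletonI)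
    then obtain m where m: "m < N" "tuple_label xs ys = l (xs ! m) (ys ! m)" by auto
    then have "S (\<pi> (xs ! m)) (\<pi> (ys ! m)) (tuple_label xs ys)"
      using hom[of "xs ! m" "ys ! m"] tuples_nth(1) D_V assms by auto
    then show ?thesis using tuples_nth(2) assms m by simp
  qed
qed

lemma mixed_label_cases:
  assumes "mixed_label (L, x) ys \<noteq> 0"
  obtains z where "z \<in> D" "ys = tup L z"
  using assms by (auto simp: mixed_label_def split: if_splits)

lemma l'_hom:
  assumes "p \<in> V'" "q \<in> V'" "l' p q \<noteq> 0"
  shows "S (\<pi>' p) (\<pi>' q) (l' p q)"
proof -
  have mixed: "S (\<pi> x) (\<pi> (hd ys)) (mixed_label (L, x) ys)"
    if "L \<in> LL" "x \<in> V" "mixed_label (L, x) ys \<noteq> 0" for L x ys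
    using that(3)
  proof (rule mixed_label_cases)
    fix z assume z: "z \<in> D" "ys = tup L z"
    then show ?thesis using that hom[of x z] D_V mixed_label_tup[OF that(1)] tup_tuples(2)[OF that(1)] by auto
  qed
  from assms show ?thesis
    unfolding V'_def
    by (elim UnE imageE SigmaE)
       (auto simp: l'_def \<pi>'_def split: if_splits intro: mixed S_sym[OF mixed] tuple_label_S hom)
qed

lemma finite_cl: "finite cl"
  by (rule finite_subset[OF _ finite_lists_length_eq[OF V_fin, of a]]) (auto simp: cliques_def)

lemma finite_V': "finite V'"
proof -
  have "finite {xs. set xs \<subseteq> D \<and> length xs = N}"
    using V_fin by (intro finite_lists_length_eq) (auto simp: D_def)
  then have "finite tuples" by (rule rev_finite_subset) (auto simp: tuples_def)
  then show ?thesis using V_fin finite_lines[OF finite_cl] by (auto simp: V'_def)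
qed

lemma over_V': "over V' l' \<pi>'"
  unfolding over_def
  using finite_V' l'_sym l'_hom \<pi>_W hd_tuples D_V by (auto simp: V'_def \<pi>'_def)

text \<open>The letters are the cliques over \<open>\<alpha>\<close>: a word of \<open>N\<close>
  cliques, read vertex by vertex, is a list of \<open>a\<close> tuples, and the words on the line
  \<open>L\<close> are the images of the cliques under \<open>copy L\<close>.\<close>

lemma step_Ramsey:
  assumes hj: "hj cl Q N" and \<psi>: "\<And>f. \<psi> f \<in> Q"
  obtains L i where "L \<in> LL" "\<And>f. f \<in> cl \<Longrightarrow> \<psi> (map (copy L) f) = i"
proof -
  define \<phi> where "\<phi> w = \<psi> (map (\<lambda>i. Inl (map (\<lambda>f. f ! i) w)) [0..<a])" for w
  have "\<forall>w. \<phi> w \<in> Q" using \<psi> by (simp add: \<phi>_def)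
  with hj obtain L i where L: "L \<in> LL" and i: "\<forall>f\<in>cl. \<phi> (subst L f) = i"
    unfolding hj_def by blast
  have "map (copy L) f = map (\<lambda>i. Inl (map (\<lambda>f. f ! i) (subst L f))) [0..<a]" if f: "f \<in> cl" for f
  proof (rule nth_equalityI)
    have len: "length f = a" using f by (auto simp: cliques_def)
    then show "length (map (copy L) f) = length (map (\<lambda>i. Inl (map (\<lambda>f. f ! i) (subst L f))) [0..<a])"
      by simp
    fix i assume "i < length (map (copy L) f)"
    then have "i < a" using len by simp
    then show "map (copy L) f ! i = map (\<lambda>i. Inl (map (\<lambda>f. f ! i) (subst L f))) [0..<a] ! i"
      using clique_nth[OF f \<open>i < a\<close>] len
      by (auto simp: copy_def tup_def subst_def split: option.splits)
  qed
  then show ?thesis using that[OF L, of i] i by (simp add: \<phi>_def)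
qed

end

definition good_upto :: "(nat list \<Rightarrow> bool) \<Rightarrow> ('v \<Rightarrow> 'v \<Rightarrow> nat \<Rightarrow> bool) \<Rightarrow> nat \<Rightarrow> bool" where
  "good_upto g R n \<longleftrightarrow> (\<forall>x w. walk R x w x \<longrightarrow> length w \<le> n \<longrightarrow> g w)"

lemma good_uptoD: "good_upto g R n \<Longrightarrow> walk R x w x \<Longrightarrow> length w \<le> n \<Longrightarrow> g w"
  by (auto simp: good_upto_def)

context template
begin

lemma S_walk_word: "walk S p w q \<Longrightarrow> set w \<subseteq> {..\<delta>}"
  using walk_labels[of S p w q "{..\<delta>}"] S_label by force

lemma over_sym: "over V l \<pi> \<Longrightarrow> edges V l x y t \<Longrightarrow> edges V l y x t"
  by (auto simp: over_def edges_def)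

lemma over_walk_S: assumes "over V l \<pi>" "walk (edges V l) x w y" shows "walk S (\<pi> x) w (\<pi> y)"
  by (rule walk_map[OF _ assms(2)]) (use assms(1) in \<open>auto simp: over_def edges_def\<close>)

lemma over_walk_word: assumes "over V l \<pi>" "walk (edges V l) x w y" shows "set w \<subseteq> {..\<delta>}"
  by (rule S_walk_word[OF over_walk_S[OF assms]])

text \<open>A picture has one label per pair even over a template with several, so a closed walk of
  two steps repeats its label. This starts the iteration.\<close>

lemma over_good_upto_2:
  assumes P: "over V l \<pi>"
  shows "good_upto good (edges V l) 2"
  unfolding good_upto_def
proof (intro allI impI)
  fix x w assume w: "walk (edges V l) x w x" "length w \<le> 2"
  have word: "set w \<subseteq> {..\<delta>}" by (rule over_walk_word[OF P w(1)])
  consider "w = []" | s where "w = [s]" | s t where "w = [s, t]"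
    using w(2) by (cases w rule: remdups_adj.cases) auto
  then show "good w"
  proof cases
    case 1
    then show ?thesis by (simp add: good_def)
  next
    case (2 s)
    then have "walk S (\<pi> x) [s] (\<pi> x)" using over_walk_S[OF P w(1)] by simp
    then show ?thesis using S_irrefl by (simp add: walk_Cons)
  next
    case (3 s t)
    then obtain y where "edges V l x y s" "edges V l y x t" using w(1) by (auto simp: walk_Cons)
    then have "s = t" using P by (auto simp: edges_def over_def)
    then show ?thesis using good_swap_edge 3 word by auto
  qed
qed

end

section \<open>Closed walks after one partite step\<close>

context partite_step
begin

lemma edges_copy:
  "L \<in> LL \<Longrightarrow> x \<in> V \<Longrightarrow> y \<in> V \<Longrightarrow> edges V' l' (copy L x) (copy L y) t \<longleftrightarrow> edges V l x y t"
  by (simp add: edges_def l'_copy copy_V')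

lemma outside_neighbour:
  assumes x: "x \<in> V" "x \<notin> D" and L: "L \<in> LL" and e: "edges V' l' (copy L x) p t"
  obtains y where "y \<in> V" "p = copy L y" "edges V l x y t"
proof -
  have p: "p \<in> V'" "l' (Inr (L, x)) p = t" "t \<noteq> 0" using e x by (auto simp: edges_def copy_def)
  have "\<exists>y\<in>V. p = copy L y"
  proof (cases p)
    case (Inl ys)
    then have "mixed_label (L, x) ys \<noteq> 0" using p by (simp add: l'_def)
    then obtain z where "z \<in> D" "ys = tup L z" by (rule mixed_label_cases)
    then show ?thesis using Inl D_V by (auto simp: copy_def)
  next
    case (Inr s)
    then obtain M y where s: "p = Inr (M, y)" by (cases s) auto
    then have "M = L" "y \<in> V" "y \<notin> D" using p by (auto simp: l'_def V'_def split: if_splits)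
    then show ?thesis using s by (auto simp: copy_def)
  qed
  then obtain y where "y \<in> V" "p = copy L y" by blast
  then show ?thesis using that e edges_copy[OF L x(1)] by blast
qed

text \<open>All neighbours of a point outside \<open>D\<close> belong to its own copy, so a copy can
  be left only through \<open>D\<close>.\<close>

lemma walk_leaves_copy:
  assumes "walk (edges V' l') (copy L x) w p" "x \<in> V" "L \<in> LL"
  shows "(\<exists>z\<in>V. walk (edges V l) x w z \<and> p = copy L z) \<or>
    (\<exists>w1 w2 y. w = w1 @ w2 \<and> y \<in> D \<and> walk (edges V l) x w1 y \<and> walk (edges V' l') (copy L y) w2 p)"
  using assms(1,2)
proof (induction w arbitrary: x)
  case Nil
  then show ?case by (intro disjI1 bexI[of _ x]) auto
next
  case (Cons t w)
  show ?case
  proof (cases "x \<in> D")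
    case True
    then show ?thesis using Cons.prems
      by (intro disjI2 exI[of _ "[]"] exI[of _ "t # w"] exI[of _ x]) simp
  next
    case False
    obtain q where q: "edges V' l' (copy L x) q t" "walk (edges V' l') q w p"
      using Cons.prems(1) by (auto simp: walk_Cons)
    obtain y where y: "y \<in> V" "q = copy L y" "edges V l x y t"
      using outside_neighbour[OF Cons.prems(2) False assms(3) q(1)] .
    from Cons.IH[OF q(2)[unfolded y(2)] y(1)] show ?thesis
    proof (elim disjE)
      assume "\<exists>z\<in>V. walk (edges V l) y w z \<and> p = copy L z"
      then show ?thesis using y(3) by (intro disjI1) (auto intro: walk.Cons)
    next
      assume "\<exists>w1 w2 y'. w = w1 @ w2 \<and> y' \<in> D \<and> walk (edges V l) y w1 y' \<and> walk (edges V' l') (copy L y') w2 p"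
      then obtain w1 w2 y' where "w = w1 @ w2" "y' \<in> D" "walk (edges V l) y w1 y'"
        "walk (edges V' l') (copy L y') w2 p" by blast
      then show ?thesis using y(3)
        by (intro disjI2 exI[of _ "t # w1"] exI[of _ w2] exI[of _ y']) (auto intro: walk.Cons)
    qed
  qed
qed

lemma S_\<alpha>_unique:
  assumes g: "good_upto good S n" "2 \<le> n" and "i < a" "j < a" "S (\<alpha> ! i) (\<alpha> ! j) t"
  shows "t = dA i j"
proof -
  have "i \<noteq> j" using assms(5) S_irrefl by auto
  then have "S (\<alpha> ! j) (\<alpha> ! i) (dA i j)" using S_\<alpha>[of i j] S_sym assms by blast
  then have "walk S (\<alpha> ! i) [t, dA i j] (\<alpha> ! i)" using assms(5) by (auto simp: walk_Cons)
  from good_uptoD[OF g(1) this] show ?thesis using g(2) good_pair by simp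
qed

text \<open>Goodness of two-step walks in the template forces every label inside the power to be the
  distance of \<open>A\<close> between the parts. The walk thus projects into \<open>A\<close>, and
  its length does not matter.\<close>

lemma closed_in_D:
  assumes g: "good_upto good S n" "2 \<le> n"
    and w: "walk (\<lambda>p q t. edges V' l' p q t \<and> \<not> p \<in> range Inr \<and> \<not> q \<in> range Inr) p w p"
  shows "good w"
proof -
  have i: "idx (\<pi>' p) < a \<and> \<alpha> ! idx (\<pi>' p) = \<pi>' p" if "p \<in> V'" "p \<notin> range Inr" for p
    using that idx_D[OF hd_tuples] by (auto simp: V'_def \<pi>'_def)
  have "walk (\<lambda>i j t. i \<in> {..<a} \<and> j \<in> {..<a} \<and> t = dA i j) (idx (\<pi>' p)) w (idx (\<pi>' p))"
  proof (rule walk_map[OF _ w])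
    fix p q t assume e: "edges V' l' p q t \<and> \<not> p \<in> range Inr \<and> \<not> q \<in> range Inr"
    then have V: "p \<in> V'" "p \<notin> range Inr" "q \<in> V'" "q \<notin> range Inr" "l' p q = t" "t \<noteq> 0"
      by (auto simp: edges_def)
    have "S (\<pi>' p) (\<pi>' q) t" using l'_hom[of p q] V by simp
    then have "S (\<alpha> ! idx (\<pi>' p)) (\<alpha> ! idx (\<pi>' q)) t" using i V by simp
    then have "t = dA (idx (\<pi>' p)) (idx (\<pi>' q))" using S_\<alpha>_unique[OF g] i V by blast
    then show "idx (\<pi>' p) \<in> {..<a} \<and> idx (\<pi>' q) \<in> {..<a} \<and> t = dA (idx (\<pi>' p)) (idx (\<pi>' q))"
      using i V by simp
  qed
  then show ?thesis by (rule admissible_closed_good[OF A])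
qed

text \<open>An excursion \<^term>\<open>u\<close> into one copy, together with the remainder \<^term>\<open>v\<close> of the closed walk, splits
  along the (virtual) edge of \<^term>\<open>\<alpha>\<close> between the end points of the excursion.\<close>

lemma glue_excursion:
  assumes gS: "good_upto good S n" and y: "y1 \<in> D" "y2 \<in> D" and L: "L \<in> LL"
    and u: "walk (edges V l) y2 u y1" "2 \<le> length u"
    and v: "walk (edges V' l') (copy L y1) v (copy L y2)" "2 \<le> length v"
    and n: "length u + length v \<le> n + 1"
  shows "good (u @ v)"
proof -
  have Su: "walk S (\<pi> y2) u (\<pi> y1)" by (rule over_walk_S[OF P u(1)])
  have Sv: "walk S (\<pi> y1) v (\<pi> y2)" using over_walk_S[OF over_V' v(1)] \<pi>'_copy[OF L] by simp
  have wd: "set u \<subseteq> {..\<delta>}" "set v \<subseteq> {..\<delta>}" using Su Sv S_walk_word by blast+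
  obtain t where "good (t # u)" "good (t # v)"
  proof (cases "\<pi> y1 = \<pi> y2")
    case True
    \<comment> \<open>With both ends in one part the halves already project to closed walks, and the
      virtual label is 0.\<close>
    then have "good u" "good v" using good_uptoD[OF gS] Su Sv n u(2) v(2) by auto
    then show ?thesis using that good_zero wd by blast
  next
    case False
    let ?t = "dA (idx (\<pi> y1)) (idx (\<pi> y2))"
    have "idx (\<pi> y1) \<noteq> idx (\<pi> y2)" using False idx_D y by metis
    then have e: "S (\<pi> y1) (\<pi> y2) ?t" using S_\<alpha> idx_D y by metis
    have "good (?t # u)" by (rule good_uptoD[OF gS walk.Cons[OF e Su]]) (use n v(2) in simp)
    moreover have "good (?t # v)"
      by (rule good_uptoD[OF gS walk.Cons[OF S_sym[OF e] Sv]]) (use n u(2) in simp)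
    ultimately show ?thesis by (rule that)
  qed
  then show ?thesis by (rule good_glue[OF wd])
qed

text \<open>The walk is followed from \<open>x\<close> in both directions until it meets
  \<open>D\<close>, in \<open>y1\<close> and \<open>y2\<close>. The two arms form an excursion into
  the copy \<open>L\<close>, to be glued with the rest of the walk.\<close>

lemma closed_through_outside:
  assumes gS: "good_upto good S n" and gP: "good_upto good (edges V l) (Suc n)"
    and x: "x \<in> V" "x \<notin> D" and L: "L \<in> LL"
    and w: "walk (edges V' l') (copy L x) w (copy L x)" "length w \<le> Suc n"
  shows "good w"
proof -
  from walk_leaves_copy[OF w(1) x(1) L] show ?thesis
  proof (elim disjE)
    assume "\<exists>z\<in>V. walk (edges V l) x w z \<and> copy L x = copy L z"
    then have "walk (edges V l) x w x" using copy_inj[OF L] by blast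
    from good_uptoD[OF gP this w(2)] show ?thesis .
  next
    assume "\<exists>w1 w2 y. w = w1 @ w2 \<and> y \<in> D \<and> walk (edges V l) x w1 y \<and>
      walk (edges V' l') (copy L y) w2 (copy L x)"
    then obtain w1 w2 y1 where 1: "w = w1 @ w2" "y1 \<in> D" "walk (edges V l) x w1 y1"
      "walk (edges V' l') (copy L y1) w2 (copy L x)" by blast
    have r: "walk (edges V' l') (copy L x) (rev w2) (copy L y1)"
      by (rule walk_rev[OF over_sym[OF over_V'] 1(4)])
    from walk_leaves_copy[OF r x(1) L] show ?thesis
    proof (elim disjE)
      assume "\<exists>z\<in>V. walk (edges V l) x (rev w2) z \<and> copy L y1 = copy L z"
      then have "walk (edges V l) x (rev w2) y1" using copy_inj[OF L] by blast
      from walk_rev[OF over_sym[OF P] this] have "walk (edges V l) x w x"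
        using 1 by (auto simp: walk_append)
      from good_uptoD[OF gP this w(2)] show ?thesis .
    next
      assume "\<exists>v1 v2 y. rev w2 = v1 @ v2 \<and> y \<in> D \<and> walk (edges V l) x v1 y \<and>
        walk (edges V' l') (copy L y) v2 (copy L y1)"
      then obtain v1 v2 y2 where 2: "rev w2 = v1 @ v2" "y2 \<in> D" "walk (edges V l) x v1 y2"
        "walk (edges V' l') (copy L y2) v2 (copy L y1)" by blast
      have w2: "w2 = rev v2 @ rev v1" using arg_cong[OF 2(1), of rev] by simp
      have v2: "walk (edges V' l') (copy L y1) (rev v2) (copy L y2)"
        by (rule walk_rev[OF over_sym[OF over_V'] 2(4)])
      have v1: "walk (edges V l) y2 (rev v1) x"
        by (rule walk_rev[OF over_sym[OF P] 2(3)])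
      have u: "walk (edges V l) y2 (rev v1 @ w1) y1" using v1 1(3) by (auto simp: walk_append)
      show ?thesis
      proof (cases "2 \<le> length v2")
        case True
        \<comment> \<open>Both arms are nonempty because \<open>x\<close> lies outside
          \<open>D\<close>, so the excursion has at least two steps.\<close>
        have "w1 \<noteq> []" "v1 \<noteq> []" using 1(2,3) 2(2,3) x by auto
        then have "2 \<le> length (rev v1 @ w1)" by (cases w1; cases v1) auto
        then have "good ((rev v1 @ w1) @ rev v2)"
          using glue_excursion[OF gS 1(2) 2(2) L u _ v2] True w(2) 1(1) w2 by simp
        moreover have "set (rev v1) \<subseteq> {..\<delta>}" "set (w1 @ rev v2) \<subseteq> {..\<delta>}"
          using over_walk_word[OF P v1] over_walk_word[OF over_V' w(1)] 1(1) w2 by auto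
        ultimately have "good ((w1 @ rev v2) @ rev v1)" using good_rotate by simp
        then show ?thesis using 1(1) w2 by simp
      next
        case False
        \<comment> \<open>A rest of at most one step is a point or an edge of the copy, since copies
          are induced; then the whole walk lies in the copy.\<close>
        have "walk (edges V l) y1 (rev v2) y2"
        proof (cases v2)
          case Nil
          then show ?thesis using v2 copy_inj[OF L] by simp
        next
          case (Cons t v3)
          then have "v2 = [t]" using False by (cases v3) auto
          then show ?thesis using v2 edges_copy[OF L D_V D_V] 1(2) 2(2) by (simp add: walk_Cons)
        qed
        then have "walk (edges V l) x w x" using 1(1,3) w2 v1 by (auto simp: walk_append)
        from good_uptoD[OF gP this w(2)] show ?thesis .
      qed
    qed
  qed
qed

theorem step_good:
  assumes gS: "good_upto good S n" and n: "2 \<le> n" and gP: "good_upto good (edges V l) (Suc n)"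
  shows "good_upto good (edges V' l') (Suc n)"
  unfolding good_upto_def
proof (intro allI impI)
  fix p w assume w: "walk (edges V' l') p w p" "length w \<le> Suc n"
  from walk_meets[OF w(1), of "\<lambda>p. p \<in> range Inr"] show "good w"
  proof
    assume "walk (\<lambda>p q t. edges V' l' p q t \<and> \<not> p \<in> range Inr \<and> \<not> q \<in> range Inr) p w p"
    then show ?thesis by (rule closed_in_D[OF gS n])
  next
    assume "\<exists>u v s. w = u @ v \<and> s \<in> range Inr \<and> walk (edges V' l') p u s \<and> walk (edges V' l') s v p"
    then obtain u v r where s: "w = u @ v" "walk (edges V' l') p u (Inr r)" "walk (edges V' l') (Inr r) v p"
      by blast
    then have vu: "walk (edges V' l') (Inr r) (v @ u) (Inr r)" by (auto simp: walk_append)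
    have wd: "set u \<subseteq> {..\<delta>}" "set v \<subseteq> {..\<delta>}" using over_walk_word[OF over_V'] s by blast+
    have "good (v @ u)"
    proof (cases "v @ u")
      case Nil
      then show ?thesis by (simp add: good_def)
    next
      case (Cons t w')
      then have "Inr r \<in> V'" using vu by (auto simp: walk_Cons edges_def)
      then obtain L x where r: "r = (L, x)" "L \<in> LL" "x \<in> V" "x \<notin> D" by (auto simp: V'_def)
      then have "copy L x = Inr r" by (simp add: copy_def)
      with vu have "walk (edges V' l') (copy L x) (v @ u) (copy L x)" by simp
      from closed_through_outside[OF gS gP r(3,4,2) this] show ?thesis using s(1) w(2) by simp
    qed
    then show ?thesis using good_rotate[OF wd(2,1)] s(1) by simp
  qed
qed

end

section \<open>Amalgamating over all copies, and iteration\<close>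

abbreviation labels :: "('v \<Rightarrow> 'v \<Rightarrow> nat) \<Rightarrow> 'v \<Rightarrow> 'v \<Rightarrow> nat \<Rightarrow> bool" where
  "labels d x y t \<equiv> t = d x y"

text \<open>All lists are coloured, so a colouring needs no domain. \<open>h\<close> runs over the
  copies of \<open>A\<close> in \<open>B\<close> as lists of indices, and
  \<open>map ((!) g) h\<close> is the corresponding copy inside \<open>g\<close>.\<close>

definition arrows :: "'v set \<Rightarrow> ('v \<Rightarrow> 'v \<Rightarrow> nat \<Rightarrow> bool) \<Rightarrow> ('v \<Rightarrow> nat) \<Rightarrow> nat \<Rightarrow> (nat \<Rightarrow> nat \<Rightarrow> nat) \<Rightarrow>
    nat \<Rightarrow> (nat \<Rightarrow> nat \<Rightarrow> nat) \<Rightarrow> nat \<Rightarrow> bool" where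
  "arrows V R \<rho> b dB a dA k \<longleftrightarrow> (\<forall>\<psi>. (\<forall>f. \<psi> f < k) \<longrightarrow> (\<exists>g i. emb V R \<rho> b dB g \<and>
     (\<forall>h. emb {..<b} (labels dB) id a dA h \<longrightarrow> \<psi> (map ((!) g) h) = i)))"

lemma arrows_mono:
  assumes "arrows V R \<rho> b dB a dA k" "\<And>x y t. x \<in> V \<Longrightarrow> y \<in> V \<Longrightarrow> \<rho> x < \<rho> y \<Longrightarrow> R x y t \<Longrightarrow> \<sigma> x < \<sigma> y \<and> R' x y t"
  shows "arrows V R' \<sigma> b dB a dA k"
proof -
  have *: "emb V R' \<sigma> b dB g" if g: "emb V R \<rho> b dB g" for g
    unfolding emb_def
  proof (intro conjI allI impI)
    show "length g = b" "set g \<subseteq> V" using g by (auto simp: emb_def)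
    fix j i assume ij: "j < b" "i < j"
    have "g ! i \<in> V" "g ! j \<in> V" using g ij by (auto simp: emb_def)
    moreover have "\<rho> (g ! i) < \<rho> (g ! j)" "R (g ! i) (g ! j) (dB i j)" using g ij by (auto simp: emb_def)
    ultimately show "\<sigma> (g ! i) < \<sigma> (g ! j)" "R' (g ! i) (g ! j) (dB i j)" using assms(2) by blast+
  qed
  show ?thesis
    unfolding arrows_def
  proof (intro allI impI)
    fix \<psi> :: "'a list \<Rightarrow> nat" assume "\<forall>f. \<psi> f < k"
    from mp[OF spec[OF assms(1)[unfolded arrows_def]] this]
    show "\<exists>g i. emb V R' \<sigma> b dB g \<and> (\<forall>h. emb {..<b} (labels dB) id a dA h \<longrightarrow> \<psi> (map ((!) g) h) = i)"
      using * by blast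
  qed
qed

context template
begin

text \<open>One partite step per copy \<open>\<alpha>\<close> of \<open>A\<close>. Colourings are
  treated backwards: the last step settles the cliques over its own \<open>\<alpha>\<close>, and the
  pullback along \<open>copy L\<close> is handed to the previous picture.\<close>

lemma picture:
  fixes V0 :: "nat set" and k :: nat
  assumes V0: "over V0 l0 \<pi>0" and \<alpha>s: "\<forall>\<alpha>\<in>set \<alpha>s. emb W S \<rho> a dA \<alpha>"
  shows "\<exists>(V :: nat set) l \<pi>. over V l \<pi> \<and>
    (\<forall>\<psi>. (\<forall>f. \<psi> f < k) \<longrightarrow> (\<exists>E. (\<forall>x\<in>V0. E x \<in> V \<and> \<pi> (E x) = \<pi>0 x) \<and>
       (\<forall>x\<in>V0. \<forall>y\<in>V0. l (E x) (E y) = l0 x y) \<and>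
       (\<forall>\<alpha>\<in>set \<alpha>s. \<exists>i. \<forall>f\<in>cliques V0 l0 \<pi>0 \<alpha>. \<psi> (map E f) = i))) \<and>
    (\<forall>n\<ge>2. good_upto good S n \<longrightarrow> good_upto good (edges V0 l0) (Suc n) \<longrightarrow> good_upto good (edges V l) (Suc n))"
  using \<alpha>s
proof (induction \<alpha>s)
  case Nil
  show ?case
    by (rule exI[of _ V0], rule exI[of _ l0], rule exI[of _ \<pi>0])
       (use V0 in \<open>auto intro!: exI[of _ "\<lambda>x. x"]\<close>)
next
  case (Cons \<alpha> \<alpha>s)
  then obtain V :: "nat set" and l \<pi> where V: "over V l \<pi>"
    and E: "\<And>\<psi>. \<forall>f. \<psi> f < k \<Longrightarrow> \<exists>E. (\<forall>x\<in>V0. E x \<in> V \<and> \<pi> (E x) = \<pi>0 x) \<and>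
       (\<forall>x\<in>V0. \<forall>y\<in>V0. l (E x) (E y) = l0 x y) \<and>
       (\<forall>\<alpha>\<in>set \<alpha>s. \<exists>i. \<forall>f\<in>cliques V0 l0 \<pi>0 \<alpha>. \<psi> (map E f) = i)"
    and G: "\<And>n. 2 \<le> n \<Longrightarrow> good_upto good S n \<Longrightarrow> good_upto good (edges V0 l0) (Suc n) \<Longrightarrow>
       good_upto good (edges V l) (Suc n)"
    by auto
  have "finite V" using V by (simp add: over_def)
  then have "finite (cliques V l \<pi> \<alpha>)"
    by (intro finite_subset[OF _ finite_lists_length_eq[of V a]]) (auto simp: cliques_def)
  then obtain N where N: "hj (cliques V l \<pi> \<alpha>) {..<k} N" using hales_jewett by blast
  have \<alpha>: "emb W S \<rho> a dA \<alpha>" using Cons.prems by simp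
  interpret partite_step \<delta> K c W S \<rho> a dA V l \<pi> \<alpha> N
    by unfold_locales (fact V \<alpha>)+
  \<comment> \<open>A step wraps the vertices in lists and sums; coding them as numbers keeps the
    induction within one type.\<close>
  define U where "U = to_nat ` V'"
  define m where "m x y = l' (from_nat x) (from_nat y)" for x y :: nat
  define \<sigma> where "\<sigma> x = \<pi>' (from_nat x)" for x :: nat
  have "over U m \<sigma>"
    using over_V' by (auto simp: over_def U_def m_def \<sigma>_def)
  moreover have "good_upto good (edges U m) (Suc n)"
    if "2 \<le> n" "good_upto good S n" "good_upto good (edges V0 l0) (Suc n)" for n
    unfolding good_upto_def
  proof (intro allI impI)
    fix x w assume w: "walk (edges U m) x w x" "length w \<le> Suc n"
    have "walk (edges V' l') (from_nat x) w (from_nat x)"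
      by (rule walk_map[OF _ w(1)]) (auto simp: edges_def U_def m_def)
    from good_uptoD[OF step_good[OF that(2,1) G[OF that]] this w(2)] show "good w" .
  qed
  moreover have "\<exists>E. (\<forall>x\<in>V0. E x \<in> U \<and> \<sigma> (E x) = \<pi>0 x) \<and>
       (\<forall>x\<in>V0. \<forall>y\<in>V0. m (E x) (E y) = l0 x y) \<and>
       (\<forall>\<alpha>\<in>set (\<alpha> # \<alpha>s). \<exists>i. \<forall>f\<in>cliques V0 l0 \<pi>0 \<alpha>. \<psi> (map E f) = i)"
    if \<psi>: "\<forall>f. \<psi> f < k" for \<psi> :: "nat list \<Rightarrow> nat"
  proof -
    have "\<psi> (map to_nat f) \<in> {..<k}" for f :: "(nat list + nat list option list \<times> nat) list"
      using \<psi> by simp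
    from step_Ramsey[OF N, of "\<lambda>f. \<psi> (map to_nat f)", OF this]
    obtain L i where L: "L \<in> LL" and i: "\<And>f. f \<in> cl \<Longrightarrow> \<psi> (map to_nat (map (copy L) f)) = i"
      by blast
    have "\<forall>f. \<psi> (map (\<lambda>x. to_nat (copy L x)) f) < k" using \<psi> by simp
    from E[OF this] obtain E where E1: "\<forall>x\<in>V0. E x \<in> V \<and> \<pi> (E x) = \<pi>0 x"
      and E2: "\<forall>x\<in>V0. \<forall>y\<in>V0. l (E x) (E y) = l0 x y"
      and E3: "\<forall>\<alpha>\<in>set \<alpha>s. \<exists>i. \<forall>f\<in>cliques V0 l0 \<pi>0 \<alpha>. \<psi> (map (\<lambda>x. to_nat (copy L x)) (map E f)) = i"
      by (elim exE conjE) (rule that)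
    have "map E f \<in> cl" if f: "f \<in> cliques V0 l0 \<pi>0 \<alpha>" for f
    proof -
      have f': "length f = a" "set f \<subseteq> V0" "map \<pi>0 f = \<alpha>" "\<forall>j<a. \<forall>i<j. l0 (f ! i) (f ! j) = dA i j"
        using f by (auto simp: cliques_def)
      have "map \<pi> (map E f) = map \<pi>0 f" using f'(2) E1 by auto
      moreover have "l (map E f ! i) (map E f ! j) = dA i j" if "j < a" "i < j" for i j
      proof -
        have "f ! i \<in> V0" "f ! j \<in> V0" using that f'(1,2) by auto
        then show ?thesis using E2 f'(1,4) that by simp
      qed
      ultimately show ?thesis using f' E1 by (auto simp: cliques_def)
    qed
    then have new: "\<psi> (map (\<lambda>x. to_nat (copy L (E x))) f) = i" if "f \<in> cliques V0 l0 \<pi>0 \<alpha>" for f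
      using i[of "map E f"] that by (simp add: comp_def)
    show ?thesis
    proof (intro exI[of _ "\<lambda>x. to_nat (copy L (E x))"] conjI ballI)
      fix x assume "x \<in> V0"
      then show "to_nat (copy L (E x)) \<in> U" "\<sigma> (to_nat (copy L (E x))) = \<pi>0 x"
        using E1 copy_V'[OF L] \<pi>'_copy[OF L] by (auto simp: U_def \<sigma>_def)
      fix y assume "y \<in> V0"
      with \<open>x \<in> V0\<close> show "m (to_nat (copy L (E x))) (to_nat (copy L (E y))) = l0 x y"
        using E1 E2 l'_copy[OF L] by (simp add: m_def)
    next
      fix \<beta> assume "\<beta> \<in> set (\<alpha> # \<alpha>s)"
      then show "\<exists>i. \<forall>f\<in>cliques V0 l0 \<pi>0 \<beta>. \<psi> (map (\<lambda>x. to_nat (copy L (E x))) f) = i"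
        using new bspec[OF E3, of \<beta>] by (auto simp: comp_def)
    qed
  qed
  ultimately show ?case by (intro exI[of _ U] exI[of _ m] exI[of _ \<sigma>] conjI allI impI) simp_all
qed

end

lemma finite_emb: "finite V \<Longrightarrow> finite {f. emb V R \<rho> n d f}"
  by (rule finite_subset[OF _ finite_lists_length_eq[of V n]]) (auto simp: emb_def)

lemma embD:
  assumes "emb V R \<rho> n d f"
  shows "length f = n" "i < n \<Longrightarrow> f ! i \<in> V" "i < j \<Longrightarrow> j < n \<Longrightarrow> \<rho> (f ! i) < \<rho> (f ! j)"
    "i < j \<Longrightarrow> j < n \<Longrightarrow> R (f ! i) (f ! j) (d i j)"
  using assms by (auto simp: emb_def)

lemma emb_comp:
  assumes g: "emb V R \<rho> b dB g" and h: "emb {..<b} (labels dB) id a dA h"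
  shows "emb V R \<rho> a dA (map ((!) g) h)"
  unfolding emb_def
proof (intro conjI allI impI)
  show "length (map ((!) g) h) = a" using embD(1)[OF h] by simp
  show "set (map ((!) g) h) \<subseteq> V" using embD(2)[OF g] h by (auto simp: emb_def)
  fix j i assume ij: "j < a" "i < j"
  then have "h ! i < h ! j" "h ! j < b" "dA i j = dB (h ! i) (h ! j)"
    using ij embD(2)[OF h, of j] embD(3,4)[OF h ij(2,1)] by auto
  then show "\<rho> (map ((!) g) h ! i) < \<rho> (map ((!) g) h ! j)" "R (map ((!) g) h ! i) (map ((!) g) h ! j) (dA i j)"
    using ij embD(3,4)[OF g] embD(1)[OF h] by auto
qed

locale nat_template = template \<delta> K c W S \<rho> a dA
  for \<delta> K c :: nat and W :: "nat set" and S \<rho> a dA +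
  fixes b :: nat and dB :: "nat \<Rightarrow> nat \<Rightarrow> nat"
  assumes B: "admissible \<delta> K c {..<b} dB"
begin

text \<open>The initial picture is the disjoint union of all copies of \<open>B\<close> in the template.\<close>

definition V0 :: "nat set" where
  "V0 = to_nat ` ({g. emb W S \<rho> b dB g} \<times> {..<b})"

definition l0 :: "nat \<Rightarrow> nat \<Rightarrow> nat" where
  "l0 x y = (case from_nat x of (g :: nat list, i) \<Rightarrow> case from_nat y of (h, j) \<Rightarrow>
     if g = h then dB i j else 0)"

definition \<pi>0 :: "nat \<Rightarrow> nat" where
  "\<pi>0 x = (case from_nat x of (g :: nat list, i) \<Rightarrow> g ! i)"

lemma l0_pair: "l0 (to_nat (g :: nat list, i :: nat)) (to_nat (h :: nat list, j :: nat)) = (if g = h then dB i j else 0)"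
  by (simp add: l0_def)

lemma \<pi>0_pair: "\<pi>0 (to_nat (g :: nat list, i :: nat)) = g ! i"
  by (simp add: \<pi>0_def)

lemma V0_E:
  assumes "x \<in> V0"
  obtains g i where "x = to_nat (g :: nat list, i :: nat)" "emb W S \<rho> b dB g" "i < b"
  using assms by (auto simp: V0_def)

lemma over_V0: "over V0 l0 \<pi>0"
  unfolding over_def
proof (intro conjI ballI impI)
  show "finite V0" unfolding V0_def using finite_emb[OF W_fin] by simp
  show "\<pi>0 ` V0 \<subseteq> W" using embD(2) by (auto elim!: V0_E simp: \<pi>0_pair)
  fix x y assume "x \<in> V0" "y \<in> V0"
  obtain g i where x: "x = to_nat (g, i)" "emb W S \<rho> b dB g" "i < b" using V0_E[OF \<open>x \<in> V0\<close>] .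
  obtain h j where y: "y = to_nat (h, j)" "emb W S \<rho> b dB h" "j < b" using V0_E[OF \<open>y \<in> V0\<close>] .
  have sym: "dB i j = dB j i" and z: "dB i j = 0 \<longleftrightarrow> i = j" using admissibleD[OF B] x y by simp_all
  show "l0 x y = l0 y x" using x y sym by (simp add: l0_pair)
  assume "l0 x y \<noteq> 0"
  then have "g = h" "i \<noteq> j" "l0 x y = dB i j" using x y z by (auto simp: l0_pair split: if_splits)
  then show "S (\<pi>0 x) (\<pi>0 y) (l0 x y)"
    using embD(4)[OF x(2), of i j] embD(4)[OF x(2), of j i] S_sym sym x y
    by (cases i j rule: linorder_cases) (auto simp: \<pi>0_pair)
qed

text \<open>Edges stay within one copy of \<open>B\<close>, so every closed walk projects into
  \<open>B\<close>, whatever its length.\<close>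

lemma good_V0: "good_upto good (edges V0 l0) n"
  unfolding good_upto_def
proof (intro allI impI)
  fix x w assume w: "walk (edges V0 l0) x w x"
  define p where "p x = snd (from_nat x :: nat list \<times> nat)" for x
  have "walk (\<lambda>i j t. i \<in> {..<b} \<and> j \<in> {..<b} \<and> t = dB i j) (p x) w (p x)"
  proof (rule walk_map[OF _ w])
    fix x y t assume e: "edges V0 l0 x y t"
    then have "x \<in> V0" "y \<in> V0" by (auto simp: edges_def)
    obtain g i where x: "x = to_nat (g, i)" "emb W S \<rho> b dB g" "i < b" using V0_E[OF \<open>x \<in> V0\<close>] .
    obtain h j where y: "y = to_nat (h, j)" "emb W S \<rho> b dB h" "j < b" using V0_E[OF \<open>y \<in> V0\<close>] .
    show "p x \<in> {..<b} \<and> p y \<in> {..<b} \<and> t = dB (p x) (p y)"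
      using e x y by (auto simp: edges_def p_def l0_pair split: if_splits)
  qed
  then show "good w" by (rule admissible_closed_good[OF B])
qed

text \<open>After \<open>picture\<close>, the colour of a clique of the embedded \<open>V0\<close>
  depends only on its projection. This colours the copies of \<open>A\<close> in the template, and a
  homogeneous \<open>g\<close> there lifts to the component of \<open>V0\<close> indexed by
  \<open>g\<close>.\<close>

theorem enlarge:
  assumes C: "arrows W S \<rho> b dB a dA k"
  shows "\<exists>(V :: nat set) l \<pi>. over V l \<pi> \<and> arrows V (edges V l) (\<rho> \<circ> \<pi>) b dB a dA k \<and>
    (\<forall>n\<ge>2. good_upto good S n \<longrightarrow> good_upto good (edges V l) (Suc n))"
proof -
  from finite_list[OF finite_emb[OF W_fin]]
  obtain \<alpha>s where \<alpha>s: "set \<alpha>s = {f. emb W S \<rho> a dA f}" ..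
  then have "\<forall>\<alpha>\<in>set \<alpha>s. emb W S \<rho> a dA \<alpha>" by simp
  from picture[OF over_V0 this, of k]
  obtain V :: "nat set" and l \<pi> where V: "over V l \<pi>"
    and E: "\<forall>\<psi>. (\<forall>f. \<psi> f < k) \<longrightarrow> (\<exists>E. (\<forall>x\<in>V0. E x \<in> V \<and> \<pi> (E x) = \<pi>0 x) \<and>
       (\<forall>x\<in>V0. \<forall>y\<in>V0. l (E x) (E y) = l0 x y) \<and>
       (\<forall>\<alpha>\<in>set \<alpha>s. \<exists>i. \<forall>f\<in>cliques V0 l0 \<pi>0 \<alpha>. \<psi> (map E f) = i))"
    and G: "\<forall>n\<ge>2. good_upto good S n \<longrightarrow> good_upto good (edges V0 l0) (Suc n) \<longrightarrow> good_upto good (edges V l) (Suc n)"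
    by (elim exE conjE) (rule that)
  have "arrows V (edges V l) (\<rho> \<circ> \<pi>) b dB a dA k"
    unfolding arrows_def
  proof (intro allI impI)
    fix \<psi> :: "nat list \<Rightarrow> nat" assume \<psi>: "\<forall>f. \<psi> f < k"
    from mp[OF spec[OF E] this] obtain E where
      E1: "\<forall>x\<in>V0. E x \<in> V \<and> \<pi> (E x) = \<pi>0 x" and
      E2: "\<forall>x\<in>V0. \<forall>y\<in>V0. l (E x) (E y) = l0 x y" and
      E3: "\<forall>\<alpha>\<in>set \<alpha>s. \<exists>i. \<forall>f\<in>cliques V0 l0 \<pi>0 \<alpha>. \<psi> (map E f) = i"
      by (elim exE conjE) (rule that)
    define col where "col \<alpha> = \<psi> (map E (SOME f. f \<in> cliques V0 l0 \<pi>0 \<alpha>))" for \<alpha>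
    have "\<forall>\<alpha>. col \<alpha> < k" using \<psi> by (simp add: col_def)
    from mp[OF spec[OF C[unfolded arrows_def]] this] obtain g i where g: "emb W S \<rho> b dB g"
      and i: "\<forall>h. emb {..<b} (labels dB) id a dA h \<longrightarrow> col (map ((!) g) h) = i"
      by (elim exE conjE) (rule that)
    define v where "v j = to_nat (g, j)" for j :: nat
    define gB where "gB = map (\<lambda>j. E (v j)) [0..<b]"
    have v: "v j \<in> V0" if "j < b" for j using that g by (auto simp: V0_def v_def)
    have l: "l (E (v i)) (E (v j)) = dB i j" if "i < b" "j < b" for i j
      using that v E2 by (simp add: v_def l0_pair)
    have \<pi>: "\<pi> (E (v j)) = g ! j" if "j < b" for j
      using that v E1 by (simp add: v_def \<pi>0_pair)
    have "emb V (edges V l) (\<rho> \<circ> \<pi>) b dB gB"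
      unfolding emb_def
    proof (intro conjI allI impI)
      show "length gB = b" by (simp add: gB_def)
      show "set gB \<subseteq> V" using v E1 by (auto simp: gB_def)
      fix j i assume ij: "j < b" "i < j"
      show "(\<rho> \<circ> \<pi>) (gB ! i) < (\<rho> \<circ> \<pi>) (gB ! j)"
        using ij embD(3)[OF g ij(2,1)] \<pi> by (simp add: gB_def)
      show "edges V l (gB ! i) (gB ! j) (dB i j)"
        using ij l v E1 admissibleD(2)[OF B, of i j] by (simp add: gB_def edges_def)
    qed
    moreover have "\<psi> (map ((!) gB) h) = i" if h: "emb {..<b} (labels dB) id a dA h" for h
    proof -
      let ?\<alpha> = "map ((!) g) h" and ?f = "map v h"
      have hb: "set h \<subseteq> {..<b}" "length h = a" using h by (auto simp: emb_def)
      have f: "?f \<in> cliques V0 l0 \<pi>0 ?\<alpha>"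
        unfolding cliques_def
      proof (intro CollectI conjI allI impI)
        show "length ?f = a" using hb by simp
        show "set ?f \<subseteq> V0" using hb v by auto
        show "map \<pi>0 ?f = ?\<alpha>" by (simp add: v_def \<pi>0_pair)
        fix j i assume "j < a" "i < j"
        then show "l0 (?f ! i) (?f ! j) = dA i j"
          using embD(4)[OF h, of i j] hb by (simp add: v_def l0_pair)
      qed
      have "?\<alpha> \<in> set \<alpha>s" using \<alpha>s emb_comp[OF g h] by simp
      from bspec[OF E3 this] have col: "\<psi> (map E ?f) = col ?\<alpha>"
        using f someI[of "\<lambda>f. f \<in> cliques V0 l0 \<pi>0 ?\<alpha>", OF f] unfolding col_def by metis
      have eq: "map ((!) gB) h = map E ?f"
        using hb by (auto simp: gB_def)
      show ?thesis unfolding eq col using i h by blast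
    qed
    ultimately show "\<exists>g i. emb V (edges V l) (\<rho> \<circ> \<pi>) b dB g \<and>
      (\<forall>h. emb {..<b} (labels dB) id a dA h \<longrightarrow> \<psi> (map ((!) g) h) = i)" by blast
  qed
  then show ?thesis using V G good_V0 by blast
qed

end

section \<open>Iteration from Ramsey's theorem to a finite space\<close>

context bounds
begin

text \<open>Distinct points carry all labels at once, so every set of \<open>b\<close> numbers,
  listed increasingly, is a copy of \<open>B\<close>; the claim becomes Ramsey's theorem for sets of
  size \<open>a\<close>.\<close>

lemma base_arrows:
  assumes B: "admissible \<delta> K c {..<b} dB"
  shows "\<exists>p :: nat. arrows {..<p} (\<lambda>x y t. x \<noteq> y \<and> t \<in> {1..\<delta>}) id b dB a dA k"
proof -
  obtain p :: nat where p: "partn_lst {..<p} (replicate k b) a" using ramsey_full[of "replicate k b" a] by blast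
  have "arrows {..<p} (\<lambda>x y t. x \<noteq> y \<and> t \<in> {1..\<delta>}) id b dB a dA k"
    unfolding arrows_def
  proof (intro allI impI)
    fix \<psi> :: "nat list \<Rightarrow> nat" assume \<psi>: "\<forall>f. \<psi> f < k"
    define F where "F X = \<psi> (sorted_list_of_set X)" for X
    have "F \<in> nsets {..<p} a \<rightarrow> {..<length (replicate k b)}" using \<psi> by (simp add: F_def)
    from bspec[OF p[unfolded partn_lst_def] this] obtain i H where
      i: "i < k" and H: "H \<in> nsets {..<p} b" and mono: "F ` nsets H a \<subseteq> {i}"
      by (auto simp: monochromatic_def)
    define g where "g = sorted_list_of_set H"
    have fin: "finite H" "H \<subseteq> {..<p}" "card H = b" using H by (auto simp: nsets_def)
    then have g: "length g = b" "set g = H" "sorted_wrt (<) g" by (auto simp: g_def)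
    have emb: "emb {..<p} (\<lambda>x y t. x \<noteq> y \<and> t \<in> {1..\<delta>}) id b dB g"
      unfolding emb_def
    proof (intro conjI allI impI)
      fix j i assume ij: "j < b" "i < j"
      then have lt: "g ! i < g ! j" using g by (simp add: sorted_wrt_iff_nth_less)
      show "id (g ! i) < id (g ! j)" "g ! i \<noteq> g ! j" using lt by simp_all
      show "dB i j \<in> {1..\<delta>}" using admissibleD[OF B, of i j] ij by simp
    qed (use g fin in simp_all)
    moreover have "\<psi> (map ((!) g) h) = i" if h: "emb {..<b} (labels dB) id a dA h" for h
    proof -
      let ?f = "map ((!) g) h"
      have f: "emb {..<p} (\<lambda>x y t. x \<noteq> y \<and> t \<in> {1..\<delta>}) id a dA ?f" by (rule emb_comp[OF emb h])
      have "set h \<subseteq> {..<b}" using h by (auto simp: emb_def)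
      then have sub: "set ?f \<subseteq> H" using g by (auto simp: subset_iff)
      have s: "sorted_wrt (<) ?f" using embD(1,3)[OF f] by (simp add: sorted_wrt_iff_nth_less)
      then have "card (set ?f) = a" using embD(1)[OF f] strict_sorted_iff distinct_card by metis
      then have "set ?f \<in> nsets H a" using sub by (simp add: nsets_def)
      then have "F (set ?f) = i" using mono by blast
      moreover have "sorted_list_of_set (set ?f) = ?f"
        using s strict_sorted_iff sorted_list_of_set.idem_if_sorted_distinct by blast
      ultimately show ?thesis by (simp only: F_def)
    qed
    ultimately show "\<exists>g i. emb {..<p} (\<lambda>x y t. x \<noteq> y \<and> t \<in> {1..\<delta>}) id b dB g \<and>
      (\<forall>h. emb {..<b} (labels dB) id a dA h \<longrightarrow> \<psi> (map ((!) g) h) = i)" by blast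
  qed
  then show ?thesis by blast
qed

definition label_graph :: "nat set \<Rightarrow> (nat \<Rightarrow> nat \<Rightarrow> nat) \<Rightarrow> bool" where
  "label_graph V l \<longleftrightarrow> finite V \<and> (\<forall>x\<in>V. l x x = 0) \<and> (\<forall>x\<in>V. \<forall>y\<in>V. l x y = l y x \<and> l x y \<le> \<delta>)"

lemma (in template) over_label_graph:
  assumes "over V l \<pi>"
  shows "label_graph V l"
proof -
  have P: "l x y \<noteq> 0 \<Longrightarrow> S (\<pi> x) (\<pi> y) (l x y)" "l x y = l y x" if "x \<in> V" "y \<in> V" for x y
    using assms that by (auto simp: over_def)
  have "l x x = 0" if "x \<in> V" for x using P(1)[OF that that] S_irrefl by blast
  moreover have "l x y \<le> \<delta>" if "x \<in> V" "y \<in> V" for x y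
    using P(1)[OF that] S_label[of "\<pi> x" "\<pi> y" "l x y"] by (cases "l x y = 0") auto
  moreover have "finite V" using assms by (simp add: over_def)
  ultimately show ?thesis using P(2) by (simp add: label_graph_def)
qed

lemma iterate:
  assumes A: "admissible \<delta> K c {..<a} dA" and B: "admissible \<delta> K c {..<b} dB" and "2 \<le> n"
  shows "\<exists>V l \<rho>. label_graph V l \<and> arrows V (edges V l) \<rho> b dB a dA k \<and> good_upto good (edges V l) n"
  using \<open>2 \<le> n\<close>
proof (induction n rule: nat_induct_at_least)
  case base
  obtain p :: nat where p: "arrows {..<p} (\<lambda>x y t. x \<noteq> y \<and> t \<in> {1..\<delta>}) id b dB a dA k"
    using base_arrows[OF B] by blast
  interpret nat_template \<delta> K c "{..<p}" "\<lambda>x y t. x \<noteq> y \<and> t \<in> {1..\<delta>}" id a dA b dB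
    by unfold_locales (use A B in auto)
  from enlarge[OF p] obtain V :: "nat set" and l \<pi> where "over V l \<pi>" "arrows V (edges V l) (id \<circ> \<pi>) b dB a dA k"
    by blast
  then show ?case using over_label_graph over_good_upto_2 by blast
next
  case (Suc n)
  then obtain W m \<rho> where W: "label_graph W m" "arrows W (edges W m) \<rho> b dB a dA k" "good_upto good (edges W m) n"
    by blast
  interpret nat_template \<delta> K c W "edges W m" \<rho> a dA b dB
    by unfold_locales (use A B W(1) in \<open>auto simp: label_graph_def edges_def\<close>)
  from enlarge[OF W(2)] obtain V :: "nat set" and l \<pi> where V: "over V l \<pi>" "arrows V (edges V l) (\<rho> \<circ> \<pi>) b dB a dA k"
    and "\<forall>n\<ge>2. good_upto good (edges W m) n \<longrightarrow> good_upto good (edges V l) (Suc n)"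
    by blast
  then have "good_upto good (edges V l) (Suc n)" using W(3) Suc.hyps by blast
  then show ?case using V over_label_graph by blast
qed

theorem finite_Ramsey:
  assumes A: "admissible \<delta> K c {..<a} dA" and B: "admissible \<delta> K c {..<b} dB"
  shows "\<exists>(V :: nat set) d \<rho>. finite V \<and> admissible \<delta> K c UNIV d \<and> inj_on \<rho> V \<and> arrows V (labels d) \<rho> b dB a dA k"
proof -
  have "2 \<le> 2 * \<delta>" using K1 K\<delta> by simp
  from iterate[OF A B this] obtain V l \<rho> where V: "label_graph V l"
    and ar: "arrows V (edges V l) \<rho> b dB a dA k" and g: "good_upto good (edges V l) (2 * \<delta>)" by blast
  have lab: "edges V l x y t \<Longrightarrow> t \<in> {1..\<delta>}" for x y t using V by (auto simp: edges_def label_graph_def)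
  interpret good_graph \<delta> K c "edges V l"
  proof unfold_locales
    show "edges V l x y t \<Longrightarrow> edges V l y x t" for x y t using V by (auto simp: edges_def label_graph_def)
    show "edges V l x y t \<Longrightarrow> t \<in> {1..\<delta>}" for x y t by (rule lab)
    show "good w" if w: "walk (edges V l) x w x" for x w
    proof (cases "length w \<le> 2 * \<delta>")
      case False
      have "set w \<subseteq> {1..\<delta>}" by (rule walk_labels[OF w lab])
      then show ?thesis by (rule good_long) (use False in simp)
    qed (use good_uptoD[OF g w] in simp)
  qed
  obtain d where d: "\<forall>x y t. edges V l x y t \<longrightarrow> d x y = t" "admissible \<delta> K c UNIV d" using completion by blast
  have fin: "finite V" using V by (simp add: label_graph_def)
  from finite_nat_set_iff_bounded[THEN iffD1, OF this]
  obtain M where M: "\<forall>x\<in>V. x < M" ..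
  \<comment> \<open>Ties of rank are broken by the vertex itself, which is below
    \<open>M\<close>.\<close>
  define \<sigma> where "\<sigma> x = \<rho> x * M + x" for x
  have "inj_on \<sigma> V"
  proof (rule inj_onI)
    fix x y assume "x \<in> V" "y \<in> V" "\<sigma> x = \<sigma> y"
    then have "(\<rho> x * M + x) mod M = (\<rho> y * M + y) mod M" by (simp add: \<sigma>_def)
    then show "x = y" using M \<open>x \<in> V\<close> \<open>y \<in> V\<close> by simp
  qed
  moreover have "\<sigma> x < \<sigma> y" if "x \<in> V" "\<rho> x < \<rho> y" for x y
  proof -
    have "\<rho> x * M + x < Suc (\<rho> x) * M" using M that(1) by simp
    also have "\<dots> \<le> \<rho> y * M" using that(2) by (intro mult_le_mono1) simp
    finally show ?thesis by (simp add: \<sigma>_def)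
  qed
  then have "arrows V (labels d) \<sigma> b dB a dA k"
    by (intro arrows_mono[OF ar]) (use d in \<open>auto simp: edges_def\<close>)
  ultimately show ?thesis using fin d(2) by blast
qed

end

section \<open>Ordered spaces\<close>

lemma linear_order_enum:
  assumes fin: "finite P" and lin: "linear_order_on P r"
  shows "\<exists>e. bij_betw e {..<card P} P \<and> (\<forall>i<card P. \<forall>j<card P. (e i, e j) \<in> r \<longleftrightarrow> i \<le> j)"
proof -
  define rk where "rk x = card {y \<in> P. (y, x) \<in> r \<and> y \<noteq> x}" for x
  have tr: "trans r" and an: "antisym r" and re: "refl_on P r" and to: "total_on P r"
    using lin by (auto simp: linear_order_on_def partial_order_on_def preorder_on_def)
  have lt: "rk x < rk y" if "x \<in> P" "y \<in> P" "(x, y) \<in> r" "x \<noteq> y" for x y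
  proof -
    have "{z \<in> P. (z, x) \<in> r \<and> z \<noteq> x} \<subset> {z \<in> P. (z, y) \<in> r \<and> z \<noteq> y}"
      using that transD[OF tr] antisymD[OF an] by blast
    then show ?thesis unfolding rk_def using fin by (intro psubset_card_mono) auto
  qed
  have iff: "rk x \<le> rk y \<longleftrightarrow> (x, y) \<in> r" if "x \<in> P" "y \<in> P" for x y
  proof (cases "x = y")
    case True
    then show ?thesis using re that by (auto simp: refl_on_def)
  next
    case False
    then have "(x, y) \<in> r \<or> (y, x) \<in> r" using to that by (auto simp: total_on_def)
    then show ?thesis using lt[of x y] lt[of y x] that False antisymD[OF an] by fastforce
  qed
  have inj: "inj_on rk P"
  proof (rule inj_onI)
    fix x y assume "x \<in> P" "y \<in> P" "rk x = rk y"
    then show "x = y" using iff[of x y] iff[of y x] antisymD[OF an] by simp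
  qed
  have "rk ` P \<subseteq> {..<card P}"
  proof
    fix n assume "n \<in> rk ` P"
    then obtain x where x: "x \<in> P" "n = rk x" by blast
    have "{y \<in> P. (y, x) \<in> r \<and> y \<noteq> x} \<subset> P" using x by blast
    then show "n \<in> {..<card P}" using psubset_card_mono[OF fin] x by (simp add: rk_def)
  qed
  then have "rk ` P = {..<card P}" using card_image[OF inj] by (intro card_subset_eq) auto
  then have bij: "bij_betw rk P {..<card P}" using inj by (simp add: bij_betw_def)
  let ?e = "inv_into P rk"
  have e: "?e i \<in> P" "rk (?e i) = i" if "i < card P" for i
    using that bij by (auto simp: bij_betw_def intro: inv_into_into f_inv_into_f)
  show ?thesis
    by (rule exI[of _ ?e]) (use bij_betw_inv_into[OF bij] e iff in \<open>metis\<close>)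
qed

lemma metric_class_admissible:
  assumes X: "X \<in> metric_class \<delta> K C" and C: "2 * \<delta> < C"
  shows "admissible \<delta> K (C - 1) (points X) (distance X)"
proof -
  let ?d = "distance X" and ?V = "points X"
  interpret Metric_space ?V "\<lambda>x y. real (?d x y)" using X by (simp add: metric_class_def)
  have sym: "?d x y = ?d y x" for x y using commute[of x y] by simp
  have z: "?d x y = 0 \<longleftrightarrow> x = y" if "x \<in> ?V" "y \<in> ?V" for x y using zero[OF that] by simp
  have le: "?d x y \<le> \<delta>" if "x \<in> ?V" "y \<in> ?V" for x y using X that by (simp add: metric_class_def)
  have tri: "?d x w \<le> ?d x y + ?d y w" if "x \<in> ?V" "y \<in> ?V" "w \<in> ?V" for x y w
    using triangle[OF that] by linarith
  have per: "?d x y + ?d y w + ?d x w \<le> C - 1 \<and>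
      (odd (?d x y + ?d y w + ?d x w) \<longrightarrow> 2 * K + 1 \<le> ?d x y + ?d y w + ?d x w)"
    if V: "x \<in> ?V" "y \<in> ?V" "w \<in> ?V" for x y w
  proof (cases "x \<noteq> y \<and> y \<noteq> w \<and> w \<noteq> x")
    case True
    then have "is_triangle ?V x y w" using V by (simp add: is_triangle_def)
    then have "perimeter ?d x y w < C" "odd (perimeter ?d x y w) \<longrightarrow> 2 * K + 1 \<le> perimeter ?d x y w"
      using X by (auto simp: metric_class_def)
    then show ?thesis using sym[of x w] by (auto simp: perimeter_def)
  next
    case False
    then consider "x = y" | "y = w" | "w = x" by blast
    then have "\<exists>s\<le>\<delta>. ?d x y + ?d y w + ?d x w = 2 * s"
    proof cases
      case 1
      then show ?thesis using V z[of y y] le[of y w] by (intro exI[of _ "?d y w"]) simp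
    next
      case 2
      then show ?thesis using V z[of w w] le[of x w] by (intro exI[of _ "?d x w"]) simp
    next
      case 3
      then show ?thesis using V z[of x x] le[of x y] sym[of y x] by (intro exI[of _ "?d x y"]) simp
    qed
    then obtain s where s: "s \<le> \<delta>" "?d x y + ?d y w + ?d x w = 2 * s" by blast
    show ?thesis unfolding s(2) using s(1) C by simp
  qed
  show ?thesis
    unfolding admissible_def
    by (intro conjI ballI sym z le tri conjunct1[OF per] conjunct2[OF per])
qed

lemma admissible_pullback:
  assumes "admissible \<delta> K c V d" "bij_betw e U V"
  shows "admissible \<delta> K c U (\<lambda>i j. d (e i) (e j))"
proof -
  have e: "e i \<in> V" if "i \<in> U" for i using assms(2) that by (auto simp: bij_betw_def)
  have inj: "e i = e j \<longleftrightarrow> i = j" if "i \<in> U" "j \<in> U" for i j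
    using assms(2) that by (auto simp: bij_betw_def inj_on_def)
  note D = admissibleD[OF assms(1)] and T = admissible_triangleD[OF assms(1)]
  show ?thesis
    unfolding admissible_def
  proof (intro conjI ballI)
    fix i j assume "i \<in> U" "j \<in> U"
    then show "d (e i) (e j) = 0 \<longleftrightarrow> i = j" using D(2)[OF e e] inj by simp
  qed (intro D T e, assumption+)+
qed

text \<open>\<open>Metric_space\<close> asks for symmetry off the points too; admissibility of
  \<open>d\<close> on \<open>UNIV\<close> supplies it.\<close>

lemma admissible_metric_class:
  assumes d: "admissible \<delta> K (C - 1) UNIV d" and "0 < C" "finite M" "inj_on \<tau> M"
  shows "\<lparr>points = M, distance = \<lambda>x y. d (\<tau> x) (\<tau> y)\<rparr> \<in> metric_class \<delta> K C"
proof -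
  have D: "d x y = d y x" "d x y = 0 \<longleftrightarrow> x = y" "d x y \<le> \<delta>" "d x z \<le> d x y + d y z"
    "d x y + d y z + d x z \<le> C - 1"
    "odd (d x y + d y z + d x z) \<longrightarrow> 2 * K + 1 \<le> d x y + d y z + d x z" for x y z
    by (intro admissibleD[OF d] admissible_triangleD[OF d] UNIV_I)+
  have per: "perimeter (\<lambda>x y. d (\<tau> x) (\<tau> y)) x y z = d (\<tau> x) (\<tau> y) + d (\<tau> y) (\<tau> z) + d (\<tau> x) (\<tau> z)" for x y z
    using D(1)[of "\<tau> z"] by (simp add: perimeter_def)
  have "Metric_space M (\<lambda>x y. real (d (\<tau> x) (\<tau> y)))"
  proof
    show "real (d (\<tau> x) (\<tau> y)) = real (d (\<tau> y) (\<tau> x))" for x y using D(1)[of "\<tau> x" "\<tau> y"] by simp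
    show "real (d (\<tau> x) (\<tau> y)) = 0 \<longleftrightarrow> x = y" if "x \<in> M" "y \<in> M" for x y
      using D(2)[of "\<tau> x" "\<tau> y"] assms(4) that by (auto simp: inj_on_def)
    show "real (d (\<tau> x) (\<tau> z)) \<le> real (d (\<tau> x) (\<tau> y)) + real (d (\<tau> y) (\<tau> z))" for x y z
      using D(4)[of "\<tau> x" "\<tau> z" "\<tau> y"] by linarith
  qed simp
  moreover have "perimeter (\<lambda>x y. d (\<tau> x) (\<tau> y)) u v w < C" for u v w
    using D(5)[of "\<tau> u" "\<tau> v" "\<tau> w"] \<open>0 < C\<close> by (simp add: per)
  ultimately show ?thesis
    using assms(3) D(3,6) by (auto simp: metric_class_def per)
qed

lemma isomorphicI:
  assumes e: "bij_betw e I (points X)" and e': "bij_betw e' I (points Y)"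
    and eq: "\<And>i j. i \<in> I \<Longrightarrow> j \<in> I \<Longrightarrow> distance Y (e' i) (e' j) = distance X (e i) (e j) \<and>
      ((e' i, e' j) \<in> order_rel Y \<longleftrightarrow> (e i, e j) \<in> order_rel X)"
  shows "isomorphic X Y"
  unfolding isomorphic_def
proof (intro exI[of _ "e' \<circ> inv_into I e"] conjI ballI)
  show "bij_betw (e' \<circ> inv_into I e) (points X) (points Y)"
    using bij_betw_trans[OF bij_betw_inv_into[OF e] e'] .
  fix x y assume xy: "x \<in> points X" "y \<in> points X"
  have i: "inv_into I e z \<in> I \<and> e (inv_into I e z) = z" if "z \<in> points X" for z
    using that e by (auto simp: bij_betw_def intro: inv_into_into f_inv_into_f)
  show "distance Y ((e' \<circ> inv_into I e) x) ((e' \<circ> inv_into I e) y) = distance X x y"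
    "(((e' \<circ> inv_into I e) x, (e' \<circ> inv_into I e) y) \<in> order_rel Y) = ((x, y) \<in> order_rel X)"
    using eq[of "inv_into I e x" "inv_into I e y"] i xy by simp_all
qed

lemma enumeration:
  assumes X: "X \<in> ordered_metric_class \<delta> K C" and C: "2 * \<delta> < C"
  shows "\<exists>(n :: nat) e. bij_betw e {..<n} (points X) \<and> (\<forall>i<n. \<forall>j<n. (e i, e j) \<in> order_rel X \<longleftrightarrow> i \<le> j) \<and>
    admissible \<delta> K (C - 1) {..<n} (\<lambda>i j. distance X (e i) (e j))"
proof -
  have t: "points (int_space.truncate X) = points X" "distance (int_space.truncate X) = distance X"
    by (simp_all add: int_space.defs)
  have M: "int_space.truncate X \<in> metric_class \<delta> K C" and lin: "linear_order_on (points X) (order_rel X)"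
    using X by (auto simp: ordered_metric_class_def)
  have "finite (points X)" using M t by (simp add: metric_class_def)
  from linear_order_enum[OF this lin] obtain e where e: "bij_betw e {..<card (points X)} (points X)"
    "\<forall>i<card (points X). \<forall>j<card (points X). (e i, e j) \<in> order_rel X \<longleftrightarrow> i \<le> j" by blast
  then show ?thesis
    using admissible_pullback[OF metric_class_admissible[OF M C, unfolded t] e(1)]
    by (intro exI[of _ "card (points X)"] exI[of _ e] conjI)
qed

lemma induced_induced:
  "S \<subseteq> T \<Longrightarrow> induced (induced X T) S = induced X S"
  by (auto simp: induced_def intro!: arg_cong[of _ _ "\<lambda>r. X\<lparr>points := S, order_rel := r\<rparr>"])

lemma induced_simps [simp]:
  "points (induced X S) = S" "distance (induced X S) = distance X" "order_rel (induced X S) = order_rel X \<inter> S \<times> S"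
  by (simp_all add: induced_def)

definition transport :: "(nat \<Rightarrow> 'a) \<Rightarrow> nat set \<Rightarrow> (nat \<Rightarrow> nat \<Rightarrow> nat) \<Rightarrow> (nat \<Rightarrow> nat) \<Rightarrow> 'a ordered_space" where
  "transport \<phi> V d \<rho> = \<lparr>points = \<phi> ` V, distance = (\<lambda>x y. d (inv \<phi> x) (inv \<phi> y)),
     order_rel = {(x, y). x \<in> \<phi> ` V \<and> y \<in> \<phi> ` V \<and> \<rho> (inv \<phi> x) \<le> \<rho> (inv \<phi> y)}\<rparr>"

lemma transport_class:
  assumes "inj \<phi>" "finite V" "admissible \<delta> K (C - 1) UNIV d" "0 < C" "inj_on \<rho> V"
  shows "transport \<phi> V d \<rho> \<in> ordered_metric_class \<delta> K C"
proof -
  have "\<lparr>points = \<phi> ` V, distance = \<lambda>x y. d (inv \<phi> x) (inv \<phi> y)\<rparr> \<in> metric_class \<delta> K C"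
    by (rule admissible_metric_class[OF assms(3,4)]) (use assms(1,2) in \<open>auto simp: inj_on_def inj_def\<close>)
  moreover have "linear_order_on (\<phi> ` V) (order_rel (transport \<phi> V d \<rho>))"
    using assms(1,5)
    by (auto simp: transport_def linear_order_on_def partial_order_on_def preorder_on_def
        refl_on_def trans_def antisym_def total_on_def inj_on_def)
  ultimately show ?thesis
    by (simp add: ordered_metric_class_def transport_def int_space.defs)
qed

theorem theorem1p2:
  fixes \<delta> K C :: nat
  assumes "\<delta> \<ge> 2" and "1 \<le> K" and "K \<le> \<delta>" and "2 * \<delta> + K < C" and "C \<le> 3 * \<delta> + 1"
  shows "Ramsey_class (ordered_metric_class \<delta> K C :: ('a::infinite) ordered_space set)"
  unfolding Ramsey_class_def
proof (intro ballI allI impI)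
  fix A B :: "'a ordered_space" and k :: nat
  assume A: "A \<in> ordered_metric_class \<delta> K C" and B: "B \<in> ordered_metric_class \<delta> K C" and k: "1 \<le> k"
  interpret bounds \<delta> K "C - 1" by unfold_locales (use assms in auto)
  have C: "2 * \<delta> < C" "0 < C" using assms by simp_all
  obtain a :: nat and eA where eA: "bij_betw eA {..<a} (points A)" "\<forall>i<a. \<forall>j<a. (eA i, eA j) \<in> order_rel A \<longleftrightarrow> i \<le> j"
    and dA: "admissible \<delta> K (C - 1) {..<a} (\<lambda>i j. distance A (eA i) (eA j))"
    using enumeration[OF A C(1)] by blast
  obtain b :: nat and eB where eB: "bij_betw eB {..<b} (points B)" "\<forall>i<b. \<forall>j<b. (eB i, eB j) \<in> order_rel B \<longleftrightarrow> i \<le> j"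
    and dB: "admissible \<delta> K (C - 1) {..<b} (\<lambda>i j. distance B (eB i) (eB j))"
    using enumeration[OF B C(1)] by blast
  let ?dA = "\<lambda>i j. distance A (eA i) (eA j)" and ?dB = "\<lambda>i j. distance B (eB i) (eB j)"
  obtain V :: "nat set" and d \<rho> where V: "finite V" "admissible \<delta> K (C - 1) UNIV d" "inj_on \<rho> V"
    and ar: "arrows V (labels d) \<rho> b ?dB a ?dA k"
    using finite_Ramsey[OF dA dB, of k] by (elim exE conjE) (rule that)
  obtain \<phi> :: "nat \<Rightarrow> 'a" where \<phi>: "inj \<phi>" using infinite_countable_subset[OF infinite_UNIV] by blast
  define Z where "Z = transport \<phi> V d \<rho>"
  have Z: "Z \<in> ordered_metric_class \<delta> K C" unfolding Z_def by (rule transport_class[OF \<phi> V(1,2) C(2) V(3)])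
  have Z_simps: "points Z = \<phi> ` V" "distance Z (\<phi> x) (\<phi> y) = d x y" for x y
    using \<phi> by (simp_all add: Z_def transport_def)
  have Z_order: "(\<phi> x, \<phi> y) \<in> order_rel Z \<longleftrightarrow> \<rho> x \<le> \<rho> y" if "x \<in> V" "y \<in> V" for x y
    using \<phi> that by (auto simp: Z_def transport_def)
  show "\<exists>Z\<in>ordered_metric_class \<delta> K C. \<forall>P. partition_into k (copies Z A) P \<longrightarrow>
      (\<exists>B'\<in>copies Z B. \<exists>i<k. copies B' A \<subseteq> P i)"
  proof (intro bexI[OF _ Z] allI impI)
    fix P assume P: "partition_into k (copies Z A) P"
    \<comment> \<open>A list receives the class containing the substructure on its points. The
      default 0, for substructures in no class, is below \<open>k\<close>.\<close>
    define \<psi> where "\<psi> f = (if \<exists>i<k. induced Z (\<phi> ` set f) \<in> P i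
      then SOME i. i < k \<and> induced Z (\<phi> ` set f) \<in> P i else 0)" for f
    have \<psi>: "\<psi> f < k \<and> induced Z (\<phi> ` set f) \<in> P (\<psi> f)" if "\<exists>i<k. induced Z (\<phi> ` set f) \<in> P i" for f
      using someI_ex[OF that] that by (simp add: \<psi>_def)
    have "\<forall>f. \<psi> f < k" using \<psi> k by (auto simp: \<psi>_def)
    from mp[OF spec[OF ar[unfolded arrows_def]] this] obtain g i where g: "emb V (labels d) \<rho> b ?dB g"
      and i: "\<forall>h. emb {..<b} (labels ?dB) id a ?dA h \<longrightarrow> \<psi> (map ((!) g) h) = i"
      by (elim exE conjE) (rule that)
    have gV: "g ! j \<in> V" if "j < b" for j using embD(2)[OF g that] .
    have mono: "\<rho> (g ! p) \<le> \<rho> (g ! q) \<longleftrightarrow> p \<le> q" if "p < b" "q < b" for p q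
      using embD(3)[OF g, of p q] embD(3)[OF g, of q p] that
      by (cases p q rule: linorder_cases) auto
    have gd: "d (g ! p) (g ! q) = ?dB p q" if "p < b" "q < b" for p q
    proof (cases p q rule: linorder_cases)
      case less
      then show ?thesis using embD(4)[OF g less that(2)] by simp
    next
      case equal
      then show ?thesis using admissibleD(2)[OF V(2), of "g ! p" "g ! p"] admissibleD(2)[OF dB, of p p] that by simp
    next
      case greater
      then show ?thesis using embD(4)[OF g greater that(1)] admissibleD(1)[OF V(2), of "g ! p" "g ! q"]
        admissibleD(1)[OF dB, of p q] that by simp
    qed
    define T where "T = (\<lambda>p. \<phi> (g ! p)) ` {..<b}"
    have T: "T \<subseteq> points Z" using gV by (auto simp: T_def Z_simps)
    have inj: "inj_on (\<lambda>p. \<phi> (g ! p)) {..<b}"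
    proof (rule inj_onI)
      fix p q assume pq: "p \<in> {..<b}" "q \<in> {..<b}" "\<phi> (g ! p) = \<phi> (g ! q)"
      then have "g ! p = g ! q" using \<phi> by (simp add: inj_eq)
      then show "p = q" using mono[of p q] mono[of q p] pq by simp
    qed
    have "isomorphic (induced Z T) B"
    proof (rule isomorphicI[of "\<lambda>p. \<phi> (g ! p)" "{..<b}" _ eB])
      show "bij_betw (\<lambda>p. \<phi> (g ! p)) {..<b} (points (induced Z T))" using inj by (simp add: bij_betw_def T_def)
    qed (use eB gV gd mono Z_order in \<open>auto simp: Z_simps T_def\<close>)
    then have TB: "induced Z T \<in> copies Z B" using T by (auto simp: copies_def)
    have sub: "X \<in> P i \<and> i < k" if X: "X \<in> copies (induced Z T) A" for X
    proof -
      obtain S where S: "S \<subseteq> T" "isomorphic (induced Z S) A" "X = induced Z S"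
        using X by (auto simp: copies_def induced_induced)
      then have "X \<in> copies Z A" using T by (auto simp: copies_def)
      then obtain j where j: "j < k" "X \<in> P j" using P by (auto simp: partition_into_def)
      obtain F where F: "bij_betw F S (points A)"
        and FA: "\<And>x y. x \<in> S \<Longrightarrow> y \<in> S \<Longrightarrow> distance A (F x) (F y) = distance Z x y \<and>
           ((F x, F y) \<in> order_rel A \<longleftrightarrow> (x, y) \<in> order_rel Z)"
        using S(2) by (auto simp: isomorphic_def)
      \<comment> \<open>\<open>u\<close> lists the copy in the order of \<open>A\<close>, and
        \<open>q\<close> below records positions in \<open>g\<close>; together they exhibit the copy
        as some \<open>h\<close> inside \<open>B\<close>.\<close>
      define u where "u j = inv_into S F (eA j)" for j
      have ubij: "bij_betw u {..<a} S"
        using bij_betw_trans[OF eA(1) bij_betw_inv_into[OF F]] by (simp add: u_def[abs_def] comp_def)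
      have u: "u j \<in> S" "F (u j) = eA j" if "j < a" for j
      proof -
        have "eA j \<in> F ` S" using that eA(1) F by (auto simp: bij_betw_def)
        then show "u j \<in> S" "F (u j) = eA j" unfolding u_def by (rule inv_into_into, rule f_inv_into_f)
      qed
      have "\<exists>p<b. u j = \<phi> (g ! p)" if "j < a" for j using u(1)[OF that] S(1) by (auto simp: T_def)
      then obtain q where q: "\<And>j. j < a \<Longrightarrow> q j < b \<and> u j = \<phi> (g ! q j)" by metis
      define h where "h = map q [0..<a]"
      have le: "q s \<le> q t \<longleftrightarrow> s \<le> t" if "s < a" "t < a" for s t
        using FA[OF u(1)[OF that(1)] u(1)[OF that(2)]] u(2) eA(2) q mono Z_order gV that by metis
      have dist: "?dA s t = ?dB (q s) (q t)" if "s < a" "t < a" for s t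
        using FA[OF u(1)[OF that(1)] u(1)[OF that(2)]] u(2) q gd that by (simp add: Z_simps)
      have h: "emb {..<b} (labels ?dB) id a ?dA h"
        unfolding emb_def
      proof (intro conjI allI impI)
        show "length h = a" by (simp add: h_def)
        show "set h \<subseteq> {..<b}" using q by (auto simp: h_def)
        fix t s assume "t < a" "s < t"
        then show "id (h ! s) < id (h ! t)" "?dA s t = ?dB (h ! s) (h ! t)"
          using le[of t s] dist[of s t] by (simp_all add: h_def not_le[symmetric])
      qed
      have "\<phi> ` set (map ((!) g) h) = u ` {..<a}"
        using q by (auto simp: h_def image_image intro!: image_cong)
      then have eq: "induced Z (\<phi> ` set (map ((!) g) h)) = X" using ubij S(3) by (simp add: bij_betw_def)
      have "\<psi> (map ((!) g) h) = i" using i h by blast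
      then show ?thesis using \<psi>[of "map ((!) g) h"] j unfolding eq by metis
    qed
    show "\<exists>B'\<in>copies Z B. \<exists>i<k. copies B' A \<subseteq> P i"
    \<comment> \<open>Without copies of \<open>A\<close> nothing bounds \<open>i\<close>, so class 0
      is taken.\<close>
    proof (rule bexI[OF _ TB], cases "copies (induced Z T) A = {}")
      case True
      then show "\<exists>i<k. copies (induced Z T) A \<subseteq> P i" using k by (intro exI[of _ 0]) simp
    next
      case False
      then show "\<exists>i<k. copies (induced Z T) A \<subseteq> P i" using sub by (intro exI[of _ i]) blast
    qed
  qed
qed

end
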